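(* Let $\{\lambda_n,\lambda_{n+1},\dots,\lambda_N\}$ be a cluster of eigenvalues satisfying the standing assumption $\lambda_{h,n-1}<\lambda_n$ and $\lambda_N<\lambda_{h,N+1}$. Then $$\delta_b(E,E_h)=\max_{u\in E^B}\|u-\Pi_h^{\mathcal{C}}u\|\le(1+\beta)\max_{u\in E^B}\|u-P_hu\|.$$
   Context: Let $\Omega\subset\mathbb{R}^d$ be a bounded Lipschitz polytope, $(\cdot,\cdot)$ and $\|\cdot\|$ the $L^2(\Omega)$ inner product and norm. Let $0<\lambda_1\le\lambda_2\le\cdots$ be the eigenvalues, repeated according to multiplicity, of the Dirichlet Laplacian in weak form: $(\nabla u_i,\nabla v)=\lambda_i(u_i,v)$ for all $v\in H^1_0(\Omega)$, with corresponding eigenfunctions $u_i\in H^1_0(\Omega)$ normalized by $(u_i,u_j)=\delta_{ij}$. Let $\mathcal{T}_h$ be a conforming simplicial mesh of $\Omega$ and $V_h=\{v_h\in H^1_0(\Omega): v_h|_K\in\mathbb{P}_p(K)\ \text{for all } K\in\mathcal{T}_h\}$, where $\mathbb{P}_p(K)$ is the space of polynomials on $K$ of degree at most $p$. Let $\lambda_{h,1}\le\lambda_{h,2}\le\cdots\le\lambda_{h,\dim V_h}$ (repeated according to multiplicity) and $u_{h,i}\in V_h$ be the exact discrete eigenpairs: $(\nabla u_{h,i},\nabla v_h)=\lambda_{h,i}(u_{h,i},v_h)$ for all $v_h\in V_h$, normalized by $(u_{h,i},u_{h,j})=\delta_{ij}$ and $(\nabla u_{h,i},\nabla u_{h,j})=\lambda_{h,i}\delta_{ij}$.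 A cluster is given by indices $1\le n\le N\le\dim V_h$ (the eigenvalues $\lambda_n,\dots,\lambda_N$ in it need not be equal); $\mathcal{C}=\{n,n+1,\dots,N\}$. Set $E=\operatorname{span}\{u_i:i\in\mathcal{C}\}$, $E_h=\operatorname{span}\{u_{h,i}:i\in\mathcal{C}\}$ and $E^B=\{u\in E:\|u\|=1\}$. Standing assumption: $\lambda_{h,n-1}<\lambda_n$ and $\lambda_N<\lambda_{h,N+1}$ (an inequality involving a discrete eigenvalue index outside $\{1,\dots,\dim V_h\}$ is void). The $L^2$ directed distance is $$\delta_b(E,E_h)=\max_{v\in E,\ \|v\|=1}\ \min_{v_h\in E_h}\|v-v_h\|.$$ $P_h:H^1_0(\Omega)\to V_h$ is the energy projector, defined by $(\nabla(u-P_hu),\nabla v_h)=0$ for all $v_h\in V_h$. $\Pi_h^{\mathcal{C}}:H^1_0(\Omega)\to E_h$ is the $L^2(\Omega)$-orthogonal projector onto $E_h$. The quantity $\beta$ is the minimal number $\beta\ge 0$ such that $$\|(I-\Pi_h^{\mathcal{C}})P_hu\|\le\beta\max_{v\in E^B}\|v-P_hv\|\quad\text{for all }u\in E^B;$$ if $\|u-P_hu\|=0$ for all $u\in E^B$, then $\beta=0$ by definition. *)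

theory Defs
  imports "HOL-Analysis.Analysis"
begin

text \<open>
  Elements of \<open>L\<^sup>2(\<Omega>)\<close> are represented by functions on the whole space, of which only the
  values on \<open>\<Omega>\<close>, up to null sets, matter. Dimension is therefore taken modulo
  almost-everywhere equality on \<open>\<Omega>\<close>.
\<close>

text \<open>The polytope need not be convex.\<close>

definition lipschitz_polytope :: "'a::euclidean_space set \<Rightarrow> bool" where
  "lipschitz_polytope \<Omega> \<longleftrightarrow>
     open \<Omega> \<and> bounded \<Omega> \<and>
     (\<exists>\<P>. finite \<P> \<and> (\<forall>P\<in>\<P>. polytope P) \<and> closure \<Omega> = \<Union>\<P>) \<and>
     (\<forall>x\<in>frontier \<Omega>. \<exists>e \<gamma> L r. norm e = 1 \<and> 0 < r \<and> L-lipschitz_on {y. y \<bullet> e = 0} \<gamma> \<and>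
        (\<forall>y\<in>ball x r. y \<in> \<Omega> \<longleftrightarrow> \<gamma> (y - (y \<bullet> e) *\<^sub>R e) < y \<bullet> e))"

definition simplicial_mesh :: "'a::euclidean_space set \<Rightarrow> 'a set set \<Rightarrow> bool" where
  "simplicial_mesh \<Omega> \<T> \<longleftrightarrow>
     triangulation \<T> \<and> (\<forall>K\<in>\<T>. int DIM('a) simplex K) \<and> \<Union>\<T> = closure \<Omega>"

definition L2 :: "'a::euclidean_space set \<Rightarrow> ('a \<Rightarrow> 'b::euclidean_space) set" where
  "L2 \<Omega> = {u \<in> borel_measurable (lebesgue_on \<Omega>). integrable (lebesgue_on \<Omega>) (\<lambda>x. (norm (u x))\<^sup>2)}"

definition L2_inner ::
    "'a::euclidean_space set \<Rightarrow> ('a \<Rightarrow> 'b::euclidean_space) \<Rightarrow> ('a \<Rightarrow> 'b) \<Rightarrow> real" where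
  "L2_inner \<Omega> u v = (\<integral>x. u x \<bullet> v x \<partial>lebesgue_on \<Omega>)"

definition L2_norm :: "'a::euclidean_space set \<Rightarrow> ('a \<Rightarrow> 'b::euclidean_space) \<Rightarrow> real" where
  "L2_norm \<Omega> u = sqrt (L2_inner \<Omega> u u)"

definition partial :: "'a::euclidean_space \<Rightarrow> ('a \<Rightarrow> real) \<Rightarrow> 'a \<Rightarrow> real" where
  "partial b f x = frechet_derivative f (at x) b"

definition classical_grad :: "('a::euclidean_space \<Rightarrow> real) \<Rightarrow> 'a \<Rightarrow> 'a" where
  "classical_grad f x = (\<Sum>b\<in>Basis. partial b f x *\<^sub>R b)"

primrec C_k :: "nat \<Rightarrow> ('a::euclidean_space \<Rightarrow> real) \<Rightarrow> bool" where
  "C_k 0 f \<longleftrightarrow> continuous_on UNIV f"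
| "C_k (Suc k) f \<longleftrightarrow> (\<forall>x. f differentiable (at x)) \<and> (\<forall>b\<in>Basis. C_k k (partial b f))"

definition test_functions :: "'a::euclidean_space set \<Rightarrow> ('a \<Rightarrow> real) set" where
  "test_functions \<Omega> =
     {\<phi>. (\<forall>k. C_k k \<phi>) \<and> compact (closure {x. \<phi> x \<noteq> 0}) \<and> closure {x. \<phi> x \<noteq> 0} \<subseteq> \<Omega>}"

definition weak_gradient ::
    "'a::euclidean_space set \<Rightarrow> ('a \<Rightarrow> real) \<Rightarrow> ('a \<Rightarrow> 'a) \<Rightarrow> bool" where
  "weak_gradient \<Omega> u g \<longleftrightarrow>
     (\<forall>\<phi>\<in>test_functions \<Omega>. \<forall>b\<in>Basis.
        (\<integral>x. u x * partial b \<phi> x \<partial>lebesgue_on \<Omega>) = - (\<integral>x. (g x \<bullet> b) * \<phi> x \<partial>lebesgue_on \<Omega>))"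

text \<open>
  \<open>H\<^sup>1\<^sub>0(\<Omega>)\<close> is the closure of the test functions in the \<open>H\<^sup>1(\<Omega>)\<close> norm. The
  approximation condition is kept in the relation between \<open>u\<close> and its weak gradient \<open>g\<close>;
  since \<open>g\<close> is unique almost everywhere, the choice in \<open>grad\<close> affects no integral below.
\<close>

definition H10_gradient ::
    "'a::euclidean_space set \<Rightarrow> ('a \<Rightarrow> real) \<Rightarrow> ('a \<Rightarrow> 'a) \<Rightarrow> bool" where
  "H10_gradient \<Omega> u g \<longleftrightarrow>
     u \<in> L2 \<Omega> \<and> g \<in> L2 \<Omega> \<and> weak_gradient \<Omega> u g \<and>
     (\<forall>\<epsilon>>0. \<exists>\<phi>\<in>test_functions \<Omega>.
        sqrt ((L2_norm \<Omega> (u - \<phi>))\<^sup>2 + (L2_norm \<Omega> (g - classical_grad \<phi>))\<^sup>2) < \<epsilon>)"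

definition H10 :: "'a::euclidean_space set \<Rightarrow> ('a \<Rightarrow> real) set" where
  "H10 \<Omega> = {u. \<exists>g. H10_gradient \<Omega> u g}"

definition grad :: "'a::euclidean_space set \<Rightarrow> ('a \<Rightarrow> real) \<Rightarrow> 'a \<Rightarrow> 'a" where
  "grad \<Omega> u = (SOME g. H10_gradient \<Omega> u g)"

definition energy :: "'a::euclidean_space set \<Rightarrow> ('a \<Rightarrow> real) \<Rightarrow> ('a \<Rightarrow> real) \<Rightarrow> real" where
  "energy \<Omega> u v = L2_inner \<Omega> (grad \<Omega> u) (grad \<Omega> v)"

definition polys :: "nat \<Rightarrow> ('a::euclidean_space \<Rightarrow> real) set" where
  "polys p = {\<lambda>x. \<Sum>\<alpha> | \<alpha> \<in> Basis \<rightarrow>\<^sub>E {..p} \<and> sum \<alpha> Basis \<le> p. c \<alpha> * (\<Prod>b\<in>Basis. (x \<bullet> b) ^ \<alpha> b) | c. True}"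

definition FE_space :: "'a::euclidean_space set \<Rightarrow> 'a set set \<Rightarrow> nat \<Rightarrow> ('a \<Rightarrow> real) set" where
  "FE_space \<Omega> \<T> p =
     {v \<in> H10 \<Omega>. \<forall>K\<in>\<T>. \<exists>q\<in>polys p. AE x in lebesgue_on (K \<inter> \<Omega>). v x = q x}"

definition lin_span :: "(nat \<Rightarrow> 'a \<Rightarrow> real) \<Rightarrow> nat set \<Rightarrow> ('a \<Rightarrow> real) set" where
  "lin_span u I = {\<lambda>x. \<Sum>i\<in>I. c i * u i x | c. True}"

definition has_L2_dim :: "'a::euclidean_space set \<Rightarrow> ('a \<Rightarrow> real) set \<Rightarrow> nat \<Rightarrow> bool" where
  "has_L2_dim \<Omega> W m \<longleftrightarrow>
     (\<exists>w. (\<forall>i<m. w i \<in> W) \<and>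
        (\<forall>c. (AE x in lebesgue_on \<Omega>. (\<Sum>i<m. c i * w i x) = 0) \<longrightarrow> (\<forall>i<m. c i = 0)) \<and>
        (\<forall>v\<in>W. \<exists>c. AE x in lebesgue_on \<Omega>. v x = (\<Sum>i<m. c i * w i x)))"

definition L2_dim :: "'a::euclidean_space set \<Rightarrow> ('a \<Rightarrow> real) set \<Rightarrow> nat" where
  "L2_dim \<Omega> W = (THE m. has_L2_dim \<Omega> W m)"

definition eigenspace ::
    "'a::euclidean_space set \<Rightarrow> ('a \<Rightarrow> real) set \<Rightarrow> real \<Rightarrow> ('a \<Rightarrow> real) set" where
  "eigenspace \<Omega> W \<mu> = {w \<in> W. \<forall>v\<in>W. energy \<Omega> w v = \<mu> * L2_inner \<Omega> w v}"

text \<open>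
  The last conjunct says that \<open>lam\<close> lists all eigenvalues, each repeated according to its
  multiplicity: the eigenspace of a number that is not an eigenvalue has dimension 0.
\<close>

definition eigensystem ::
    "'a::euclidean_space set \<Rightarrow> ('a \<Rightarrow> real) set \<Rightarrow> nat set \<Rightarrow> (nat \<Rightarrow> real) \<Rightarrow> (nat \<Rightarrow> 'a \<Rightarrow> real) \<Rightarrow> bool"
where
  "eigensystem \<Omega> W I lam u \<longleftrightarrow>
     mono_on I lam \<and>
     (\<forall>i\<in>I. u i \<in> eigenspace \<Omega> W (lam i)) \<and>
     (\<forall>i\<in>I. \<forall>j\<in>I. L2_inner \<Omega> (u i) (u j) = (if i = j then 1 else 0)) \<and>
     (\<forall>\<mu>. finite {i\<in>I. lam i = \<mu>} \<and> has_L2_dim \<Omega> (eigenspace \<Omega> W \<mu>) (card {i\<in>I. lam i = \<mu>}))"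

definition unit_sphere :: "'a::euclidean_space set \<Rightarrow> ('a \<Rightarrow> real) set \<Rightarrow> ('a \<Rightarrow> real) set" where
  "unit_sphere \<Omega> E = {u \<in> E. L2_norm \<Omega> u = 1}"

definition directed_dist ::
    "'a::euclidean_space set \<Rightarrow> ('a \<Rightarrow> real) set \<Rightarrow> ('a \<Rightarrow> real) set \<Rightarrow> real" where
  "directed_dist \<Omega> E F =
     (GREATEST r. \<exists>v\<in>unit_sphere \<Omega> E. r = (LEAST s. \<exists>w\<in>F. s = L2_norm \<Omega> (v - w)))"

text \<open>For the subspaces used, both projections are unique up to null sets.\<close>

definition energy_proj ::
    "'a::euclidean_space set \<Rightarrow> ('a \<Rightarrow> real) set \<Rightarrow> ('a \<Rightarrow> real) \<Rightarrow> 'a \<Rightarrow> real" where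
  "energy_proj \<Omega> V u = (SOME w. w \<in> V \<and> (\<forall>v\<in>V. energy \<Omega> (u - w) v = 0))"

definition L2_proj ::
    "'a::euclidean_space set \<Rightarrow> ('a \<Rightarrow> real) set \<Rightarrow> ('a \<Rightarrow> real) \<Rightarrow> 'a \<Rightarrow> real" where
  "L2_proj \<Omega> W u = (SOME w. w \<in> W \<and> (\<forall>v\<in>W. L2_inner \<Omega> (u - w) v = 0))"

definition max_proj_err ::
    "'a::euclidean_space set \<Rightarrow> ('a \<Rightarrow> real) set \<Rightarrow> (('a \<Rightarrow> real) \<Rightarrow> 'a \<Rightarrow> real) \<Rightarrow> real" where
  "max_proj_err \<Omega> E Q = (GREATEST r. \<exists>v\<in>unit_sphere \<Omega> E. r = L2_norm \<Omega> (v - Q v))"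

definition cluster_beta ::
    "'a::euclidean_space set \<Rightarrow> ('a \<Rightarrow> real) set \<Rightarrow> ('a \<Rightarrow> real) set \<Rightarrow> ('a \<Rightarrow> real) set \<Rightarrow> real" where
  "cluster_beta \<Omega> V E Eh =
     (if \<forall>u\<in>unit_sphere \<Omega> E. L2_norm \<Omega> (u - energy_proj \<Omega> V u) = 0 then 0
      else (LEAST \<beta>. 0 \<le> \<beta> \<and>
        (\<forall>u\<in>unit_sphere \<Omega> E.
           L2_norm \<Omega> (energy_proj \<Omega> V u - L2_proj \<Omega> Eh (energy_proj \<Omega> V u))
             \<le> \<beta> * max_proj_err \<Omega> E (energy_proj \<Omega> V))))"

end

theory Submission
  imports Defs
begin

text \<open>
  The estimate is a best-approximation argument. For \<open>u \<in> E\<close> with \<open>\<parallel>u\<parallel> = 1\<close>, the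
  \<open>L\<^sup>2\<close>-projection \<open>\<Pi>\<close> onto \<open>E\<^sub>h\<close> minimises the distance, so with the energy projector \<open>P\<close>
  \<open>\<parallel>u - \<Pi> u\<parallel> \<le> \<parallel>u - \<Pi> (P u)\<parallel> \<le> \<parallel>u - P u\<parallel> + \<parallel>P u - \<Pi> (P u)\<parallel> \<le> (1 + \<beta>) M\<close>,
  where \<open>M\<close> is the maximum of \<open>\<parallel>v - P v\<parallel>\<close> over the unit sphere of \<open>E\<close>. By the same minimality
  (\<open>best_approximation\<close>) the distance of \<open>u\<close> to \<open>E\<^sub>h\<close> is \<open>\<parallel>u - \<Pi> u\<parallel>\<close>, which gives the equality.

  The work lies in showing that every object in this chain exists. The maxima, \<open>\<beta>\<close> and the
  projections are given by \<open>GREATEST\<close>, \<open>LEAST\<close> and \<open>SOME\<close>, and all functions matter only up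
  to null sets.

  \<^item> The energy is defined through an arbitrarily chosen weak gradient, so bilinearity
    requires uniqueness of the gradient (\<open>H10_gradient_unique\<close>). If \<open>h\<close> is a gradient of \<open>0\<close>, it
    is a limit of classical gradients of test functions. On the other hand \<open>h\<close> is orthogonal
    to all those gradients, because partial derivatives of test functions are again test
    functions. Hence \<open>(h, h) = 0\<close>.
  \<^item> The finite element space is finite-dimensional, so the orthonormal discrete
    eigenfunctions, whose number is the dimension, span it
    (\<open>discrete_eigenfunctions_span\<close>). They are orthogonal for the energy with diagonal
    entries \<open>\<lambda>\<^sub>h\<^sub>,\<^sub>i\<close>, which yields \<open>P\<close> explicitly once these numbers are nonzero.
  \<^item> The energy is definite (\<open>energy_definite\<close>): a function of energy \<open>0\<close> is
    energy-orthogonal to everything (\<open>null_orthogonal\<close>), hence an eigenfunction for the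
    eigenvalue \<open>0\<close>, whose multiplicity is \<open>0\<close> as \<open>\<lambda>\<^sub>1 > 0\<close>.
    In particular the discrete eigenvalues are nonzero and \<open>P\<close> is unique up to null sets.
  \<^item> Both projections are therefore linear up to null sets, and the squared projection error
    is a quadratic form in the coefficients of \<open>u\<close>; it attains its maximum on the unit sphere
    by compactness (\<open>max_proj_err_attained\<close>).

  The separation of the cluster enters when \<open>u = P u\<close> almost everywhere for all \<open>u \<in> E\<close>.
  Then \<open>\<beta> = 0\<close> by convention, and the claim becomes \<open>E \<subseteq> E\<^sub>h\<close> up to null sets. In that case each \<open>u\<^sub>i\<close> is a discrete
  eigenfunction for \<open>\<lambda>\<^sub>i\<close>, hence a combination of those \<open>u\<^sub>h\<^sub>,\<^sub>j\<close> with \<open>\<lambda>\<^sub>h\<^sub>,\<^sub>j = \<lambda>\<^sub>i\<close>, and the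
  separation forces such \<open>j\<close> into the cluster.
\<close>

section \<open>Semi-inner products on spaces of functions\<close>

definition linear_subspace :: "('c \<Rightarrow> 'b::real_vector) set \<Rightarrow> bool" where
  "linear_subspace W \<longleftrightarrow> (\<lambda>x. 0) \<in> W \<and>
     (\<forall>f\<in>W. \<forall>g\<in>W. \<forall>a b. (\<lambda>x. a *\<^sub>R f x + b *\<^sub>R g x) \<in> W)"

lemma linear_subspaceD:
  "linear_subspace W \<Longrightarrow> f \<in> W \<Longrightarrow> g \<in> W \<Longrightarrow> (\<lambda>x. a *\<^sub>R f x + b *\<^sub>R g x) \<in> W"
  by (auto simp: linear_subspace_def)

lemma linear_subspace_diff:
  assumes "linear_subspace W" "f \<in> W" "g \<in> W"
  shows "f - g \<in> W"
  using linear_subspaceD[OF assms, of 1 "-1"] by (simp add: fun_diff_def)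

lemma linear_subspace_sum:
  assumes "linear_subspace W" "finite I" "\<And>i. i \<in> I \<Longrightarrow> u i \<in> W"
  shows "(\<lambda>x. \<Sum>i\<in>I. c i *\<^sub>R u i x) \<in> W"
  using assms(2,3)
proof (induction I)
  case empty
  then show ?case using assms(1) by (simp add: linear_subspace_def)
next
  case (insert i I)
  then show ?case
    using linear_subspaceD[OF assms(1), of "u i" "\<lambda>x. \<Sum>i\<in>I. c i *\<^sub>R u i x" "c i" 1] by simp
qed

text \<open>
  One setting for both forms in play, the \<open>L\<^sup>2\<close> inner product and the energy. Definiteness is
  left out: functions that vanish almost everywhere are null for both.
\<close>

locale semi_inner_space =
  fixes X :: "('c \<Rightarrow> 'b::real_vector) set" and B :: "('c \<Rightarrow> 'b) \<Rightarrow> ('c \<Rightarrow> 'b) \<Rightarrow> real"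
  assumes subspace: "linear_subspace X"
    and sym: "f \<in> X \<Longrightarrow> g \<in> X \<Longrightarrow> B f g = B g f"
    and lin: "f \<in> X \<Longrightarrow> g \<in> X \<Longrightarrow> h \<in> X \<Longrightarrow> B (\<lambda>x. a *\<^sub>R f x + b *\<^sub>R g x) h = a * B f h + b * B g h"
    and nonneg: "f \<in> X \<Longrightarrow> 0 \<le> B f f"
begin

lemmas diff_mem = linear_subspace_diff[OF subspace]
lemmas sum_mem = linear_subspace_sum[OF subspace]
lemmas lin_mem = linear_subspaceD[OF subspace]

lemma lin_right:
  "f \<in> X \<Longrightarrow> g \<in> X \<Longrightarrow> h \<in> X \<Longrightarrow> B h (\<lambda>x. a *\<^sub>R f x + b *\<^sub>R g x) = a * B h f + b * B h g"
  using lin[of f g h a b] sym[of h "\<lambda>x. a *\<^sub>R f x + b *\<^sub>R g x"] sym[of f h] sym[of g h]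
    lin_mem[of f g a b] by simp

lemma diff_left: "f \<in> X \<Longrightarrow> g \<in> X \<Longrightarrow> h \<in> X \<Longrightarrow> B (f - g) h = B f h - B g h"
  using lin[of f g h 1 "-1"] by (simp add: fun_diff_def)

lemma diff_right: "f \<in> X \<Longrightarrow> g \<in> X \<Longrightarrow> h \<in> X \<Longrightarrow> B h (f - g) = B h f - B h g"
  using lin_right[of f g h 1 "-1"] by (simp add: fun_diff_def)

lemma sum_left:
  assumes "finite I" "\<And>i. i \<in> I \<Longrightarrow> u i \<in> X" "h \<in> X"
  shows "B (\<lambda>x. \<Sum>i\<in>I. c i *\<^sub>R u i x) h = (\<Sum>i\<in>I. c i * B (u i) h)"
  using assms(1,2)
proof (induction I)
  case empty
  have "(\<lambda>x. 0) \<in> X" using subspace by (simp add: linear_subspace_def)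
  from lin[OF this this assms(3), of 0 0] show ?case by simp
next
  case (insert i I)
  have "B (\<lambda>x. c i *\<^sub>R u i x + 1 *\<^sub>R (\<Sum>i\<in>I. c i *\<^sub>R u i x)) h
      = c i * B (u i) h + 1 * B (\<lambda>x. \<Sum>i\<in>I. c i *\<^sub>R u i x) h"
    by (rule lin) (use insert.prems insert.hyps assms(3) sum_mem[of I u c] in auto)
  then show ?case using insert by simp
qed

lemma sum_right:
  assumes "finite I" "\<And>i. i \<in> I \<Longrightarrow> u i \<in> X" "h \<in> X"
  shows "B h (\<lambda>x. \<Sum>i\<in>I. c i *\<^sub>R u i x) = (\<Sum>i\<in>I. c i * B h (u i))"
proof -
  have "B h (\<lambda>x. \<Sum>i\<in>I. c i *\<^sub>R u i x) = (\<Sum>i\<in>I. c i * B (u i) h)"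
    using sum_left[OF assms] sym[OF assms(3) sum_mem[OF assms(1,2)]] by simp
  also have "\<dots> = (\<Sum>i\<in>I. c i * B h (u i))"
    using sym[OF assms(2,3)] by (intro sum.cong) simp_all
  finally show ?thesis .
qed

text \<open>
  If \<open>B f f = 0\<close>, then \<open>B (t f + g) (t f + g) = 2 t B f g + B g g\<close> is affine in \<open>t\<close>, so it can only
  stay nonnegative if its slope vanishes.
\<close>

lemma null_orthogonal:
  assumes "f \<in> X" "g \<in> X" "B f f = 0"
  shows "B f g = 0"
proof (rule ccontr)
  assume ne: "B f g \<noteq> 0"
  \<comment> \<open>The value of \<open>t\<close> at which the affine function equals \<open>- 1\<close>.\<close>
  define t where "t = - (B g g + 1) / (2 * B f g)"
  have t: "2 * t * B f g = - (B g g + 1)" using ne by (simp add: t_def field_simps)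
  let ?h = "\<lambda>x. t *\<^sub>R f x + 1 *\<^sub>R g x"
  have h: "?h \<in> X" by (intro lin_mem assms)
  have "B ?h ?h = t * B f ?h + 1 * B g ?h"
    by (intro lin assms h)
  also have "\<dots> = 2 * t * B f g + B g g"
    using assms sym[of f g] lin_right[OF assms(1,2), of _ t 1] by (simp add: algebra_simps)
  also have "\<dots> < 0" using t by simp
  finally show False using nonneg[OF h] by simp
qed

lemma Cauchy_Schwarz:
  assumes "f \<in> X" "g \<in> X"
  shows "\<bar>B f g\<bar> \<le> sqrt (B f f) * sqrt (B g g)"
proof (cases "B f f = 0")
  case True
  then show ?thesis using null_orthogonal assms by simp
next
  case False
  then have pos: "B f f > 0" using nonneg[OF assms(1)] by simp
  \<comment> \<open>Up to the factor \<open>B f f\<close>, the component of \<open>g\<close> orthogonal to \<open>f\<close>.\<close>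
  let ?h = "\<lambda>x. (- B f g) *\<^sub>R f x + B f f *\<^sub>R g x"
  have h: "?h \<in> X" by (intro lin_mem assms)
  have "B ?h ?h = (- B f g) * B f ?h + B f f * B g ?h"
    by (intro lin assms h)
  also have "\<dots> = B f f * (B f f * B g g - (B f g)\<^sup>2)"
    unfolding lin_right[OF assms assms(1)] lin_right[OF assms assms(2)]
    using sym[of f g] assms by (simp add: algebra_simps power2_eq_square)
  finally have "0 \<le> B f f * (B f f * B g g - (B f g)\<^sup>2)" using nonneg[OF h] by simp
  then have "(B f g)\<^sup>2 \<le> B f f * B g g" using pos by (simp add: zero_le_mult_iff)
  then have "sqrt ((B f g)\<^sup>2) \<le> sqrt (B f f * B g g)" by (rule real_sqrt_le_mono)
  then show ?thesis by (simp add: real_sqrt_mult)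
qed

lemma triangle:
  assumes "f \<in> X" "g \<in> X" "h \<in> X"
  shows "sqrt (B (f - h) (f - h)) \<le> sqrt (B (f - g) (f - g)) + sqrt (B (g - h) (g - h))"
proof -
  let ?a = "f - g" and ?b = "g - h"
  have ab: "?a \<in> X" "?b \<in> X" using diff_mem assms by auto
  have e: "f - h = (\<lambda>x. 1 *\<^sub>R ?a x + 1 *\<^sub>R ?b x)" by auto
  have "B (f - h) (f - h) = B ?a ?a + 2 * B ?a ?b + B ?b ?b"
    unfolding e
    apply (subst lin[OF ab lin_mem[OF ab]])
    using lin_right[OF ab ab(1), of 1 1] lin_right[OF ab ab(2), of 1 1] sym[OF ab] by simp
  also have "\<dots> \<le> (sqrt (B ?a ?a))\<^sup>2 + 2 * (sqrt (B ?a ?a) * sqrt (B ?b ?b)) + (sqrt (B ?b ?b))\<^sup>2"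
    using Cauchy_Schwarz[OF ab] nonneg ab by simp
  also have "\<dots> = (sqrt (B ?a ?a) + sqrt (B ?b ?b))\<^sup>2" by (simp add: power2_sum)
  finally show ?thesis
    by (rule real_le_lsqrt[rotated]) (auto simp: nonneg ab)
qed

text \<open>
  Pythagoras: \<open>f - z\<close> splits into the orthogonal parts \<open>f - w\<close> and \<open>w - z \<in> W\<close>.
\<close>

lemma best_approximation:
  assumes W: "linear_subspace W" "W \<subseteq> X" and "f \<in> X" "w \<in> W" "z \<in> W"
    and orth: "\<And>v. v \<in> W \<Longrightarrow> B (f - w) v = 0"
  shows "B (f - w) (f - w) \<le> B (f - z) (f - z)"
proof -
  let ?a = "f - w" and ?b = "w - z"
  have bW: "?b \<in> W" using linear_subspace_diff W assms by blast
  have ab: "?a \<in> X" "?b \<in> X" using diff_mem assms bW by auto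
  have e: "f - z = (\<lambda>x. 1 *\<^sub>R ?a x + 1 *\<^sub>R ?b x)" by auto
  have "B (f - z) (f - z) = B ?a ?a + 2 * B ?a ?b + B ?b ?b"
    unfolding e
    apply (subst lin[OF ab lin_mem[OF ab]])
    using lin_right[OF ab ab(1), of 1 1] lin_right[OF ab ab(2), of 1 1] sym[OF ab] by simp
  then show ?thesis using orth[OF bW] nonneg ab by simp
qed

text \<open>
  The projection is the Fourier sum \<open>\<Sum>j. (B f (e j) / d j) e j\<close>. Spanning is meant
  modulo what \<open>B\<close> can see, as bases of \<open>W\<close> will be given modulo null sets.
\<close>

lemma orthogonal_projection_exists:
  assumes W: "linear_subspace W" "W \<subseteq> X" and J: "finite J" "\<And>j. j \<in> J \<Longrightarrow> e j \<in> W"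
    and orth: "\<And>i j. i \<in> J \<Longrightarrow> j \<in> J \<Longrightarrow> B (e i) (e j) = (if i = j then d i else 0)"
    and d: "\<And>j. j \<in> J \<Longrightarrow> d j \<noteq> 0"
    and span: "\<And>v. v \<in> W \<Longrightarrow> \<exists>c. \<forall>g\<in>X. B g v = B g (\<lambda>x. \<Sum>j\<in>J. c j *\<^sub>R e j x)"
    and f: "f \<in> X"
  shows "\<exists>w. w \<in> W \<and> (\<forall>v\<in>W. B (f - w) v = 0)"
proof -
  define w where "w = (\<lambda>x. \<Sum>j\<in>J. (B f (e j) / d j) *\<^sub>R e j x)"
  have w: "w \<in> W" unfolding w_def by (rule linear_subspace_sum[OF W(1) J])
  have eX: "e j \<in> X" if "j \<in> J" for j using that J W by auto
  have fw: "f - w \<in> X" using diff_mem f w W by blast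
  have j0: "B (f - w) (e j) = 0" if "j \<in> J" for j
  proof -
    have "B w (e j) = (\<Sum>i\<in>J. B f (e i) / d i * B (e i) (e j))"
      unfolding w_def by (rule sum_left) (use J eX that in auto)
    also have "\<dots> = (\<Sum>i\<in>J. if i = j then B f (e j) else 0)"
      by (rule sum.cong) (use orth d that in auto)
    finally have "B w (e j) = B f (e j)" using J that by simp
    moreover have "B (f - w) (e j) = B f (e j) - B w (e j)"
      by (rule diff_left) (use f w W eX that in auto)
    ultimately show ?thesis by simp
  qed
  have "B (f - w) v = 0" if v: "v \<in> W" for v
  proof -
    obtain c where c: "\<forall>g\<in>X. B g v = B g (\<lambda>x. \<Sum>j\<in>J. c j *\<^sub>R e j x)" using span[OF v] by blast
    have "B (f - w) v = (\<Sum>j\<in>J. c j * B (f - w) (e j))"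
      using bspec[OF c fw] sum_right[where I = J and u = e and c = c and h = "f - w"] J(1) eX fw by simp
    then show ?thesis using j0 by simp
  qed
  then show ?thesis using w by blast
qed

text \<open>
  The form is a continuous function of the coefficients, and the coefficient sphere is compact.
\<close>

lemma max_on_unit_coefficients:
  assumes I: "finite I" "I \<noteq> {}" "\<And>i. i \<in> I \<Longrightarrow> e i \<in> X"
  shows "\<exists>c. (\<Sum>i\<in>I. (c i)\<^sup>2) = 1 \<and> (\<forall>d. (\<Sum>i\<in>I. (d i)\<^sup>2) = 1 \<longrightarrow>
     B (\<lambda>x. \<Sum>i\<in>I. d i *\<^sub>R e i x) (\<lambda>x. \<Sum>i\<in>I. d i *\<^sub>R e i x)
       \<le> B (\<lambda>x. \<Sum>i\<in>I. c i *\<^sub>R e i x) (\<lambda>x. \<Sum>i\<in>I. c i *\<^sub>R e i x))"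
proof -
  define Q where "Q d = B (\<lambda>x. \<Sum>i\<in>I. d i *\<^sub>R e i x) (\<lambda>x. \<Sum>i\<in>I. d i *\<^sub>R e i x)" for d
  have Q: "Q d = (\<Sum>i\<in>I. d i * (\<Sum>j\<in>I. d j * B (e i) (e j)))" for d
  proof -
    have "Q d = (\<Sum>i\<in>I. d i * B (e i) (\<lambda>x. \<Sum>i\<in>I. d i *\<^sub>R e i x))"
      unfolding Q_def by (intro sum_left sum_mem I)
    also have "\<dots> = (\<Sum>i\<in>I. d i * (\<Sum>j\<in>I. d j * B (e i) (e j)))"
      by (intro sum.cong arg_cong2[where f = "(*)"] sum_right refl I)
    finally show ?thesis .
  qed
  have coord: "continuous_on S (\<lambda>d::_ \<Rightarrow> real. d i)" for i S
    by (rule continuous_on_subset[OF continuous_on_product_coordinates]) simp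
  \<comment> \<open>Coefficients live on the whole index type; setting them to 0 outside \<open>I\<close> makes the
    sphere a closed subset of a compact product.\<close>
  define K where "K i = (if i \<in> I then {-1..1::real} else {0})" for i
  define S where "S = {d. (\<Sum>i\<in>I. (d i)\<^sup>2) = 1} \<inter> Pi\<^sub>E UNIV K"
  have "compact (Pi\<^sub>E UNIV K)"
  proof -
    have "compactin (product_topology (\<lambda>i. euclidean) UNIV) (Pi\<^sub>E UNIV K)"
      unfolding compactin_PiE by (auto simp: K_def)
    then show ?thesis by (simp add: euclidean_product_topology)
  qed
  moreover have "closed {d. (\<Sum>i\<in>I. (d i)\<^sup>2) = (1::real)}"
    by (intro closed_Collect_eq continuous_on_sum continuous_on_power continuous_on_const coord)
  ultimately have "compact S" unfolding S_def by (intro closed_Int_compact)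
  have inS: "(\<lambda>i. if i \<in> I then d i else 0) \<in> S" if d: "(\<Sum>i\<in>I. (d i)\<^sup>2) = 1" for d
  proof -
    have "\<bar>d i\<bar> \<le> 1" if "i \<in> I" for i
    proof -
      have "(d i)\<^sup>2 \<le> (\<Sum>i\<in>I. (d i)\<^sup>2)" using I that by (intro member_le_sum) auto
      then show ?thesis using d by (simp add: abs_square_le_1)
    qed
    then have "(if i \<in> I then d i else 0) \<in> K i" for i
      by (auto simp: K_def abs_le_iff minus_le_iff)
    moreover have "(\<Sum>i\<in>I. (if i \<in> I then d i else 0)\<^sup>2) = 1"
      unfolding d[symmetric] by (rule sum.cong) auto
    ultimately show ?thesis unfolding S_def by blast
  qed
  obtain i0 where i0: "i0 \<in> I" using I by blast
  have "(\<Sum>i\<in>I. (if i = i0 then 1 else 0::real)\<^sup>2) = (\<Sum>i\<in>I. if i = i0 then 1 else 0)"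
    by (rule sum.cong) auto
  then have "S \<noteq> {}" using inS[of "\<lambda>i. if i = i0 then 1 else 0"] I i0 by auto
  moreover have "continuous_on S Q"
  proof -
    have "Q = (\<lambda>d. \<Sum>i\<in>I. d i * (\<Sum>j\<in>I. d j * B (e i) (e j)))" using Q by blast
    then show ?thesis by (simp only:) (intro continuous_on_sum continuous_on_mult continuous_on_const coord)
  qed
  ultimately obtain c where c: "c \<in> S" "\<forall>d\<in>S. Q d \<le> Q c"
    using continuous_attains_sup[OF \<open>compact S\<close>] by blast
  have "Q d \<le> Q c" if d: "(\<Sum>i\<in>I. (d i)\<^sup>2) = 1" for d
  proof -
    have "Q (\<lambda>i. if i \<in> I then d i else 0) = Q d" unfolding Q by (intro sum.cong) auto
    then show ?thesis using c(2) inS[OF d] by metis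
  qed
  moreover have "(\<Sum>i\<in>I. (c i)\<^sup>2) = 1" using c(1) by (simp add: S_def)
  ultimately show ?thesis unfolding Q_def by blast
qed

end

section \<open>The space of square integrable functions\<close>

lemma L2D:
  assumes "f \<in> L2 \<Omega>"
  shows "f \<in> borel_measurable (lebesgue_on \<Omega>)" "integrable (lebesgue_on \<Omega>) (\<lambda>x. (norm (f x))\<^sup>2)"
  using assms by (auto simp: L2_def)

lemma L2_inner_integrable:
  fixes f g :: "'a::euclidean_space \<Rightarrow> 'b::euclidean_space"
  assumes "f \<in> L2 \<Omega>" "g \<in> L2 \<Omega>"
  shows "integrable (lebesgue_on \<Omega>) (\<lambda>x. f x \<bullet> g x)"
proof (rule Bochner_Integration.integrable_bound)
  show "integrable (lebesgue_on \<Omega>) (\<lambda>x. (norm (f x))\<^sup>2 + (norm (g x))\<^sup>2)"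
    using assms by (intro Bochner_Integration.integrable_add L2D)
  show "(\<lambda>x. f x \<bullet> g x) \<in> borel_measurable (lebesgue_on \<Omega>)"
    using L2D(1)[OF assms(1)] L2D(1)[OF assms(2)] by simp
  have "\<bar>a \<bullet> b\<bar> \<le> (norm a)\<^sup>2 + (norm b)\<^sup>2" for a b :: 'b
  proof -
    have "\<bar>a \<bullet> b\<bar> \<le> norm a * norm b" by (rule Cauchy_Schwarz_ineq2)
    moreover have "2 * (norm a * norm b) \<le> (norm a)\<^sup>2 + (norm b)\<^sup>2"
      using sum_squares_bound[of "norm a" "norm b"] by simp
    moreover have "0 \<le> norm a * norm b" by simp
    ultimately show ?thesis by linarith
  qed
  then show "AE x in lebesgue_on \<Omega>. norm (f x \<bullet> g x) \<le> norm ((norm (f x))\<^sup>2 + (norm (g x))\<^sup>2)"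
    by simp
qed

lemma L2_subspace: "linear_subspace (L2 \<Omega> :: ('a::euclidean_space \<Rightarrow> 'b::euclidean_space) set)"
proof -
  have "(\<lambda>x. a *\<^sub>R f x + b *\<^sub>R g x) \<in> L2 \<Omega>" if f: "f \<in> L2 \<Omega>" and g: "g \<in> L2 \<Omega>"
    for f g :: "'a \<Rightarrow> 'b" and a b
  proof -
    have "(norm (a *\<^sub>R f x + b *\<^sub>R g x))\<^sup>2
        = a\<^sup>2 * (norm (f x))\<^sup>2 + b\<^sup>2 * (norm (g x))\<^sup>2 + 2 * a * b * (f x \<bullet> g x)" for x
      unfolding power2_norm_eq_inner
      by (simp add: inner_add_left inner_add_right inner_commute power2_eq_square)
    then have "integrable (lebesgue_on \<Omega>) (\<lambda>x. (norm (a *\<^sub>R f x + b *\<^sub>R g x))\<^sup>2)"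
      using L2D(2)[OF f] L2D(2)[OF g] L2_inner_integrable[OF f g] by simp
    then show ?thesis using L2D(1)[OF f] L2D(1)[OF g] by (simp add: L2_def)
  qed
  then show ?thesis by (auto simp: linear_subspace_def) (simp add: L2_def)
qed

lemma L2_semi_inner_space:
  "semi_inner_space (L2 \<Omega> :: ('a::euclidean_space \<Rightarrow> 'b::euclidean_space) set) (L2_inner \<Omega>)"
proof
  show "linear_subspace (L2 \<Omega> :: ('a \<Rightarrow> 'b) set)" by (rule L2_subspace)
  fix f g h :: "'a \<Rightarrow> 'b" and a b :: real
  assume f: "f \<in> L2 \<Omega>"
  show "0 \<le> L2_inner \<Omega> f f" by (simp add: L2_inner_def)
  assume g: "g \<in> L2 \<Omega>"
  show "L2_inner \<Omega> f g = L2_inner \<Omega> g f" by (simp add: L2_inner_def inner_commute)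
  assume h: "h \<in> L2 \<Omega>"
  show "L2_inner \<Omega> (\<lambda>x. a *\<^sub>R f x + b *\<^sub>R g x) h = a * L2_inner \<Omega> f h + b * L2_inner \<Omega> g h"
    using L2_inner_integrable[OF f h] L2_inner_integrable[OF g h]
    by (simp add: L2_inner_def inner_add_left)
qed

lemma L2_inner_cong:
  assumes "f \<in> L2 \<Omega>" "f' \<in> L2 \<Omega>" "g \<in> L2 \<Omega>" "g' \<in> L2 \<Omega>"
    and "AE x in lebesgue_on \<Omega>. f x = f' x" "AE x in lebesgue_on \<Omega>. g x = g' x"
  shows "L2_inner \<Omega> f g = L2_inner \<Omega> f' g'"
  unfolding L2_inner_def
proof (rule integral_cong_AE)
  show "AE x in lebesgue_on \<Omega>. f x \<bullet> g x = f' x \<bullet> g' x"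
    using assms(5,6) by eventually_elim simp
qed (intro borel_measurable_integrable L2_inner_integrable assms)+

lemma L2_inner_self_eq_0_iff:
  assumes "f \<in> L2 \<Omega>"
  shows "L2_inner \<Omega> f f = 0 \<longleftrightarrow> (AE x in lebesgue_on \<Omega>. f x = 0)"
  unfolding L2_inner_def
  using integral_nonneg_eq_0_iff_AE[OF L2_inner_integrable[OF assms assms]] by simp

lemma L2_norm_cong:
  assumes "f \<in> L2 \<Omega>" "f' \<in> L2 \<Omega>" "AE x in lebesgue_on \<Omega>. f x = f' x"
  shows "L2_norm \<Omega> f = L2_norm \<Omega> f'"
  using L2_inner_cong[OF assms(1,2,1,2,3,3)] by (simp add: L2_norm_def)

lemma L2_norm_eq_0_iff:
  "f \<in> L2 \<Omega> \<Longrightarrow> L2_norm \<Omega> f = 0 \<longleftrightarrow> (AE x in lebesgue_on \<Omega>. f x = 0)"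
  by (simp add: L2_norm_def L2_inner_self_eq_0_iff)

section \<open>Test functions\<close>

lemma partial_lin:
  assumes "\<And>x. f differentiable at x" "\<And>x. g differentiable at x"
  shows "partial v (\<lambda>x. a * f x + b * g x) = (\<lambda>x. a * partial v f x + b * partial v g x)"
proof
  fix x
  have "((\<lambda>x. a * f x + b * g x) has_derivative
      (\<lambda>h. a * frechet_derivative f (at x) h + b * frechet_derivative g (at x) h)) (at x)"
    using assms by (intro derivative_intros) (simp_all flip: frechet_derivative_works)
  from fun_cong[OF frechet_derivative_at[OF this], of v]
  show "partial v (\<lambda>x. a * f x + b * g x) x = a * partial v f x + b * partial v g x"
    by (simp add: partial_def)
qed

lemma partial_eq_0:
  assumes "open U" "x \<in> U" "\<And>y. y \<in> U \<Longrightarrow> f y = 0"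
  shows "partial v f x = 0"
proof -
  have "frechet_derivative (\<lambda>x. 0::real) (at x) = frechet_derivative f (at x)"
    by (rule frechet_derivative_transform_within_open[OF _ assms(1,2)]) (use assms in auto)
  then show ?thesis by (metis partial_def frechet_derivative_const)
qed

lemma C_k_lin:
  "C_k k f \<Longrightarrow> C_k k g \<Longrightarrow> C_k k (\<lambda>x. a * f x + b * g x)"
proof (induction k arbitrary: f g)
  case 0
  then show ?case by (auto intro!: continuous_intros)
next
  case (Suc k)
  have d: "partial v (\<lambda>x. a * f x + b * g x) = (\<lambda>x. a * partial v f x + b * partial v g x)" for v
    by (rule partial_lin) (use Suc in auto)
  from Suc show ?case by (auto simp: d intro!: derivative_intros)
qed

lemma compact_if_closed_subset:
  fixes A K :: "'a::heine_borel set"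
  shows "closed A \<Longrightarrow> A \<subseteq> K \<Longrightarrow> compact K \<Longrightarrow> compact A"
  using bounded_subset by (auto simp: compact_eq_bounded_closed)

lemma test_functions_lin:
  assumes f: "f \<in> test_functions \<Omega>" and g: "g \<in> test_functions \<Omega>"
  shows "(\<lambda>x. a * f x + b * g x) \<in> test_functions \<Omega>"
proof -
  let ?s = "\<lambda>f::'a \<Rightarrow> real. closure {x. f x \<noteq> 0}"
  have "?s (\<lambda>x. a * f x + b * g x) \<subseteq> closure ({x. f x \<noteq> 0} \<union> {x. g x \<noteq> 0})"
    by (rule closure_mono) auto
  then have sub: "?s (\<lambda>x. a * f x + b * g x) \<subseteq> ?s f \<union> ?s g" by simp
  have "compact (?s f \<union> ?s g)" using f g by (auto simp: test_functions_def)
  then have "compact (?s (\<lambda>x. a * f x + b * g x))"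
    by (rule compact_if_closed_subset[OF closed_closure sub])
  then show ?thesis using sub f g by (auto simp: test_functions_def intro: C_k_lin)
qed

text \<open>
  The closure of the test functions under partial derivatives is what makes the weak gradient
  closable below.
\<close>

lemma partial_test_function:
  assumes f: "f \<in> test_functions \<Omega>" and b: "b \<in> Basis"
  shows "partial b f \<in> test_functions \<Omega>"
proof -
  let ?s = "closure {x. f x \<noteq> 0}"
  have "partial b f x = 0" if "x \<notin> ?s" for x
    by (rule partial_eq_0[of "- ?s"]) (use that closure_subset[of "{x. f x \<noteq> 0}"] in auto)
  then have "{x. partial b f x \<noteq> 0} \<subseteq> ?s" by auto
  then have sub: "closure {x. partial b f x \<noteq> 0} \<subseteq> ?s" by (simp add: closure_minimal)
  have "compact ?s" using f by (simp add: test_functions_def)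
  then have "compact (closure {x. partial b f x \<noteq> 0})"
    by (rule compact_if_closed_subset[OF closed_closure sub])
  moreover have "C_k k (partial b f)" for k
  proof -
    have "C_k (Suc k) f" using f by (simp add: test_functions_def del: C_k.simps)
    then show ?thesis using b by simp
  qed
  ultimately show ?thesis using sub f by (auto simp: test_functions_def)
qed

lemma test_function_differentiable: "f \<in> test_functions \<Omega> \<Longrightarrow> f differentiable at x"
proof -
  assume "f \<in> test_functions \<Omega>"
  then have "C_k (Suc 0) f" unfolding test_functions_def by blast
  then show ?thesis by simp
qed

lemma test_function_L2:
  assumes \<Omega>: "open \<Omega>" "bounded \<Omega>" and f: "f \<in> test_functions \<Omega>"
  shows "f \<in> L2 \<Omega>"
proof -
  have "C_k 0 f" using f unfolding test_functions_def by blast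
  then have cont: "continuous_on UNIV f" by simp
  have \<Omega>m: "\<Omega> \<in> lmeasurable" using \<Omega> by (simp add: lmeasurable_open)
  have m: "f \<in> borel_measurable (lebesgue_on \<Omega>)"
    using continuous_imp_measurable_on_sets_lebesgue[OF continuous_on_subset[OF cont]] \<Omega>m
    by (simp add: fmeasurableD)
  have "compact (f ` closure {x. f x \<noteq> 0})"
    using f cont continuous_on_subset by (auto simp: test_functions_def intro!: compact_continuous_image)
  from compact_imp_bounded[OF this]
  obtain M where "\<forall>x\<in>closure {x. f x \<noteq> 0}. \<bar>f x\<bar> \<le> M"
    by (auto simp: bounded_iff)
  then have M: "\<bar>f x\<bar> \<le> M" if "x \<in> closure {x. f x \<noteq> 0}" for x using that by blast
  have M': "\<bar>f x\<bar> \<le> max M 0" for x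
    using M[of x] closure_subset[of "{x. f x \<noteq> 0}"] by (cases "f x = 0") (auto simp: le_max_iff_disj)
  interpret finite_measure "lebesgue_on \<Omega>" by (rule finite_measure_lebesgue_on[OF \<Omega>m])
  have "integrable (lebesgue_on \<Omega>) (\<lambda>x. (norm (f x))\<^sup>2)"
  proof (rule integrable_const_bound)
    show "AE x in lebesgue_on \<Omega>. norm ((norm (f x))\<^sup>2) \<le> (max M 0)\<^sup>2"
      using power_mono[OF M', of _ 2] by simp
  qed (use m in simp)
  then show ?thesis using m by (simp add: L2_def)
qed

section \<open>Weak gradients and the energy form\<close>

lemma classical_grad_L2:
  fixes \<Omega> :: "'a::euclidean_space set"
  assumes "open \<Omega>" "bounded \<Omega>" "f \<in> test_functions \<Omega>"
  shows "classical_grad f \<in> L2 \<Omega>"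
proof -
  have "(\<lambda>x. partial b f x *\<^sub>R b) \<in> L2 \<Omega>" if "b \<in> Basis" for b
  proof -
    have p: "partial b f \<in> L2 \<Omega>"
      by (intro test_function_L2 partial_test_function assms that)
    show ?thesis using L2D[OF p] that by (simp add: L2_def)
  qed
  from linear_subspace_sum[OF L2_subspace finite_Basis this, where c = "\<lambda>_. 1"]
  have "(\<lambda>x. \<Sum>b\<in>Basis. partial b f x *\<^sub>R b) \<in> L2 \<Omega>" by simp
  then show ?thesis by (simp add: classical_grad_def[abs_def])
qed

lemma classical_grad_lin:
  assumes "f \<in> test_functions \<Omega>" "g \<in> test_functions \<Omega>"
  shows "classical_grad (\<lambda>x. a * f x + b * g x) = (\<lambda>x. a *\<^sub>R classical_grad f x + b *\<^sub>R classical_grad g x)"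
proof
  fix x
  have "partial v (\<lambda>x. a * f x + b * g x) = (\<lambda>x. a * partial v f x + b * partial v g x)" for v
    by (rule partial_lin; rule test_function_differentiable; fact)
  then show "classical_grad (\<lambda>x. a * f x + b * g x) x = a *\<^sub>R classical_grad f x + b *\<^sub>R classical_grad g x"
    by (simp add: classical_grad_def scaleR_sum_right algebra_simps sum.distrib)
qed

lemma L2_times_integrable:
  fixes f g :: "'a::euclidean_space \<Rightarrow> real"
  shows "f \<in> L2 \<Omega> \<Longrightarrow> g \<in> L2 \<Omega> \<Longrightarrow> integrable (lebesgue_on \<Omega>) (\<lambda>x. f x * g x)"
  using L2_inner_integrable[of f \<Omega> g] by simp

lemma L2_component:
  fixes g :: "'a::euclidean_space \<Rightarrow> 'a"
  assumes g: "g \<in> L2 \<Omega>" and b: "b \<in> Basis"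
  shows "(\<lambda>x. g x \<bullet> b) \<in> L2 \<Omega>"
proof -
  have m: "(\<lambda>x. g x \<bullet> b) \<in> borel_measurable (lebesgue_on \<Omega>)"
    using L2D(1)[OF g] by simp
  have "integrable (lebesgue_on \<Omega>) (\<lambda>x. (g x \<bullet> b)\<^sup>2)"
  proof (rule Bochner_Integration.integrable_bound[OF L2D(2)[OF g]])
    have "(g x \<bullet> b)\<^sup>2 \<le> (norm (g x))\<^sup>2" for x
      using Basis_le_norm[OF b, of "g x"] power_mono[of "\<bar>g x \<bullet> b\<bar>" "norm (g x)" 2] by simp
    then show "AE x in lebesgue_on \<Omega>. norm ((g x \<bullet> b)\<^sup>2) \<le> norm ((norm (g x))\<^sup>2)" by simp
  qed (use m in simp)
  then show ?thesis using m by (simp add: L2_def)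
qed

lemma weak_gradient_lin:
  fixes \<Omega> :: "'a::euclidean_space set"
  assumes \<Omega>: "open \<Omega>" "bounded \<Omega>"
    and L: "u \<in> L2 \<Omega>" "v \<in> L2 \<Omega>" "g \<in> L2 \<Omega>" "h \<in> L2 \<Omega>"
    and w: "weak_gradient \<Omega> u g" "weak_gradient \<Omega> v h"
  shows "weak_gradient \<Omega> (\<lambda>x. a * u x + c * v x) (\<lambda>x. a *\<^sub>R g x + c *\<^sub>R h x)"
  unfolding weak_gradient_def
proof (intro ballI)
  fix \<phi> and b :: 'a
  assume \<phi>: "\<phi> \<in> test_functions \<Omega>" and b: "b \<in> Basis"
  note T = test_function_L2[OF \<Omega>]
  have p: "partial b \<phi> \<in> L2 \<Omega>" by (intro T partial_test_function \<phi> b)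
  note i = L2_times_integrable[OF L(1) p] L2_times_integrable[OF L(2) p]
    L2_times_integrable[OF L2_component[OF L(3) b] T[OF \<phi>]]
    L2_times_integrable[OF L2_component[OF L(4) b] T[OF \<phi>]]
  have "(\<integral>x. (a * u x + c * v x) * partial b \<phi> x \<partial>lebesgue_on \<Omega>)
      = a * (\<integral>x. u x * partial b \<phi> x \<partial>lebesgue_on \<Omega>) + c * (\<integral>x. v x * partial b \<phi> x \<partial>lebesgue_on \<Omega>)"
    using i by (simp add: distrib_right mult.assoc)
  moreover have "(\<integral>x. ((a *\<^sub>R g x + c *\<^sub>R h x) \<bullet> b) * \<phi> x \<partial>lebesgue_on \<Omega>)
      = a * (\<integral>x. (g x \<bullet> b) * \<phi> x \<partial>lebesgue_on \<Omega>) + c * (\<integral>x. (h x \<bullet> b) * \<phi> x \<partial>lebesgue_on \<Omega>)"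
    using i by (simp add: inner_add_left distrib_right mult.assoc)
  ultimately show "(\<integral>x. (a * u x + c * v x) * partial b \<phi> x \<partial>lebesgue_on \<Omega>)
      = - (\<integral>x. ((a *\<^sub>R g x + c *\<^sub>R h x) \<bullet> b) * \<phi> x \<partial>lebesgue_on \<Omega>)"
    using w \<phi> b by (simp add: weak_gradient_def)
qed

lemma L2_norm_lin_le:
  fixes f g :: "'a::euclidean_space \<Rightarrow> 'b::euclidean_space"
  assumes "f \<in> L2 \<Omega>" "g \<in> L2 \<Omega>"
  shows "L2_norm \<Omega> (\<lambda>x. a *\<^sub>R f x + c *\<^sub>R g x) \<le> \<bar>a\<bar> * L2_norm \<Omega> f + \<bar>c\<bar> * L2_norm \<Omega> g"
proof -
  interpret semi_inner_space "L2 \<Omega> :: ('a \<Rightarrow> 'b) set" "L2_inner \<Omega>" by (rule L2_semi_inner_space)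
  have zero: "(\<lambda>x. 0 :: 'b) \<in> L2 \<Omega>" using subspace by (simp add: linear_subspace_def)
  have scale: "L2_norm \<Omega> (\<lambda>x. r *\<^sub>R k x) = \<bar>r\<bar> * L2_norm \<Omega> k" for r and k :: "'a \<Rightarrow> 'b"
    unfolding L2_norm_def L2_inner_def by (simp add: real_sqrt_mult flip: mult.assoc)
  have s: "(\<lambda>x. a *\<^sub>R f x) \<in> L2 \<Omega>" "(\<lambda>x. (- c) *\<^sub>R g x) \<in> L2 \<Omega>"
    using lin_mem[OF assms(1) zero, of a 0] lin_mem[OF assms(2) zero, of "-c" 0] by simp_all
  have e: "(\<lambda>x. a *\<^sub>R f x + c *\<^sub>R g x) = (\<lambda>x. a *\<^sub>R f x) - (\<lambda>x. (- c) *\<^sub>R g x)"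
    "(\<lambda>x. a *\<^sub>R f x) = (\<lambda>x. a *\<^sub>R f x) - (\<lambda>x. 0)" "(\<lambda>x. c *\<^sub>R g x) = (\<lambda>x. 0) - (\<lambda>x. (- c) *\<^sub>R g x)"
    by auto
  have "L2_norm \<Omega> ((\<lambda>x. a *\<^sub>R f x) - (\<lambda>x. (- c) *\<^sub>R g x))
      \<le> L2_norm \<Omega> ((\<lambda>x. a *\<^sub>R f x) - (\<lambda>x. 0)) + L2_norm \<Omega> ((\<lambda>x. 0) - (\<lambda>x. (- c) *\<^sub>R g x))"
    unfolding L2_norm_def by (rule triangle[OF s(1) zero s(2)])
  then show ?thesis using scale e by metis
qed

text \<open>
  With separate bounds for the function and its gradient, approximations of two functions can be
  combined linearly.
\<close>

lemma H10_gradient_approx_iff: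
  assumes "u \<in> L2 \<Omega>"
  shows "(\<forall>\<epsilon>>0. \<exists>\<phi>\<in>test_functions \<Omega>.
        sqrt ((L2_norm \<Omega> (u - \<phi>))\<^sup>2 + (L2_norm \<Omega> (g - classical_grad \<phi>))\<^sup>2) < \<epsilon>) \<longleftrightarrow>
    (\<forall>\<epsilon>>0. \<exists>\<phi>\<in>test_functions \<Omega>. L2_norm \<Omega> (u - \<phi>) < \<epsilon> \<and> L2_norm \<Omega> (g - classical_grad \<phi>) < \<epsilon>)"
    (is "?l \<longleftrightarrow> ?r")
proof
  have nn: "0 \<le> L2_norm \<Omega> f" for f :: "'a \<Rightarrow> 'c::euclidean_space"
    by (simp add: L2_norm_def L2_inner_def)
  show "?l \<Longrightarrow> ?r" by (meson real_sqrt_sum_squares_ge1 real_sqrt_sum_squares_ge2 le_less_trans)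
  assume r: ?r
  show ?l
  proof (intro allI impI)
    fix \<epsilon> :: real assume "\<epsilon> > 0"
    then obtain \<phi> where \<phi>: "\<phi> \<in> test_functions \<Omega>" "L2_norm \<Omega> (u - \<phi>) < \<epsilon> / 2"
      "L2_norm \<Omega> (g - classical_grad \<phi>) < \<epsilon> / 2"
      using r by (metis half_gt_zero)
    have "sqrt ((L2_norm \<Omega> (u - \<phi>))\<^sup>2 + (L2_norm \<Omega> (g - classical_grad \<phi>))\<^sup>2) < \<epsilon>"
      using sqrt_sum_squares_le_sum[OF nn nn, of "u - \<phi>" "g - classical_grad \<phi>"] \<phi> by linarith
    then show "\<exists>\<phi>\<in>test_functions \<Omega>. sqrt ((L2_norm \<Omega> (u - \<phi>))\<^sup>2 + (L2_norm \<Omega> (g - classical_grad \<phi>))\<^sup>2) < \<epsilon>"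
      using \<phi>(1) by blast
  qed
qed

lemma H10_gradient_alt:
  "H10_gradient \<Omega> u g \<longleftrightarrow> u \<in> L2 \<Omega> \<and> g \<in> L2 \<Omega> \<and> weak_gradient \<Omega> u g \<and>
    (\<forall>\<epsilon>>0. \<exists>\<phi>\<in>test_functions \<Omega>. L2_norm \<Omega> (u - \<phi>) < \<epsilon> \<and> L2_norm \<Omega> (g - classical_grad \<phi>) < \<epsilon>)"
  unfolding H10_gradient_def using H10_gradient_approx_iff by blast

lemma H10_gradient_lin:
  fixes \<Omega> :: "'a::euclidean_space set"
  assumes \<Omega>: "open \<Omega>" "bounded \<Omega>" and u: "H10_gradient \<Omega> u g" and v: "H10_gradient \<Omega> v h"
  shows "H10_gradient \<Omega> (\<lambda>x. a * u x + c * v x) (\<lambda>x. a *\<^sub>R g x + c *\<^sub>R h x)"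
proof -
  have L: "u \<in> L2 \<Omega>" "g \<in> L2 \<Omega>" "v \<in> L2 \<Omega>" "h \<in> L2 \<Omega>"
    and W: "weak_gradient \<Omega> u g" "weak_gradient \<Omega> v h"
    using u v by (auto simp: H10_gradient_alt)
  have "\<exists>\<phi>\<in>test_functions \<Omega>. L2_norm \<Omega> ((\<lambda>x. a * u x + c * v x) - \<phi>) < \<epsilon> \<and>
      L2_norm \<Omega> ((\<lambda>x. a *\<^sub>R g x + c *\<^sub>R h x) - classical_grad \<phi>) < \<epsilon>" if e: "\<epsilon> > 0" for \<epsilon>
  proof -
    define \<delta> where "\<delta> = \<epsilon> / (\<bar>a\<bar> + \<bar>c\<bar> + 1)"
    have \<delta>: "\<delta> > 0" using e by (simp add: \<delta>_def)
    have small: "\<bar>a\<bar> * s + \<bar>c\<bar> * t < \<epsilon>" if "s < \<delta>" "t < \<delta>" for s t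
    proof -
      have "\<bar>a\<bar> * s + \<bar>c\<bar> * t \<le> \<bar>a\<bar> * \<delta> + \<bar>c\<bar> * \<delta>"
        using that by (intro add_mono mult_left_mono) auto
      also have "\<dots> = (\<bar>a\<bar> + \<bar>c\<bar> + 1) * \<delta> - \<delta>" by (simp add: algebra_simps)
      also have "(\<bar>a\<bar> + \<bar>c\<bar> + 1) * \<delta> = \<epsilon>" by (simp add: \<delta>_def add_nonneg_pos)
      finally show ?thesis using \<delta> by simp
    qed
    obtain \<phi> where \<phi>: "\<phi> \<in> test_functions \<Omega>" "L2_norm \<Omega> (u - \<phi>) < \<delta>" "L2_norm \<Omega> (g - classical_grad \<phi>) < \<delta>"
      using u \<delta> unfolding H10_gradient_alt by blast
    obtain \<psi> where \<psi>: "\<psi> \<in> test_functions \<Omega>" "L2_norm \<Omega> (v - \<psi>) < \<delta>" "L2_norm \<Omega> (h - classical_grad \<psi>) < \<delta>"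
      using v \<delta> unfolding H10_gradient_alt by blast
    let ?\<theta> = "\<lambda>x. a * \<phi> x + c * \<psi> x"
    have t: "?\<theta> \<in> test_functions \<Omega>" by (rule test_functions_lin[OF \<phi>(1) \<psi>(1)])
    note T = test_function_L2[OF \<Omega>] and G = classical_grad_L2[OF \<Omega>]
    have e1: "(\<lambda>x. a * u x + c * v x) - ?\<theta> = (\<lambda>x. a *\<^sub>R (u - \<phi>) x + c *\<^sub>R (v - \<psi>) x)"
      by (auto simp: algebra_simps)
    have e2: "(\<lambda>x. a *\<^sub>R g x + c *\<^sub>R h x) - classical_grad ?\<theta>
        = (\<lambda>x. a *\<^sub>R (g - classical_grad \<phi>) x + c *\<^sub>R (h - classical_grad \<psi>) x)"
      unfolding classical_grad_lin[OF \<phi>(1) \<psi>(1)] by (auto simp: algebra_simps)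
    have "L2_norm \<Omega> ((\<lambda>x. a * u x + c * v x) - ?\<theta>) < \<epsilon>"
      unfolding e1
      by (rule le_less_trans[OF L2_norm_lin_le small])
        (intro linear_subspace_diff[OF L2_subspace] L T \<phi> \<psi>)+
    moreover have "L2_norm \<Omega> ((\<lambda>x. a *\<^sub>R g x + c *\<^sub>R h x) - classical_grad ?\<theta>) < \<epsilon>"
      unfolding e2
      by (rule le_less_trans[OF L2_norm_lin_le small])
        (intro linear_subspace_diff[OF L2_subspace] L G \<phi> \<psi>)+
    ultimately show ?thesis using t by blast
  qed
  moreover have "(\<lambda>x. a * u x + c * v x) \<in> L2 \<Omega>" "(\<lambda>x. a *\<^sub>R g x + c *\<^sub>R h x) \<in> L2 \<Omega>"
    using linear_subspaceD[OF L2_subspace L(1,3), of a c] linear_subspaceD[OF L2_subspace L(2,4)] by simp_all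
  ultimately show ?thesis
    using weak_gradient_lin[OF \<Omega> L(1,3,2,4) W] unfolding H10_gradient_alt by blast
qed

text \<open>
  Closability. Testing the weak gradient \<open>g\<close> of \<open>0\<close> with the partial derivatives of a test
  function \<open>\<phi>\<close> gives \<open>(g, \<nabla>\<phi>) = 0\<close>. Since such \<open>\<nabla>\<phi>\<close> approximate \<open>g\<close>, also \<open>(g, g) = 0\<close>.
\<close>

lemma H10_gradient_of_null:
  fixes \<Omega> :: "'a::euclidean_space set"
  assumes \<Omega>: "open \<Omega>" "bounded \<Omega>" and H: "H10_gradient \<Omega> u g"
    and u: "AE x in lebesgue_on \<Omega>. u x = 0"
  shows "AE x in lebesgue_on \<Omega>. g x = 0"
proof -
  interpret semi_inner_space "L2 \<Omega> :: ('a \<Rightarrow> 'a) set" "L2_inner \<Omega>" by (rule L2_semi_inner_space)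
  have g: "g \<in> L2 \<Omega>" and W: "weak_gradient \<Omega> u g" using H by (auto simp: H10_gradient_alt)
  have z: "(\<integral>x. (g x \<bullet> b) * \<phi> x \<partial>lebesgue_on \<Omega>) = 0" if "\<phi> \<in> test_functions \<Omega>" "b \<in> Basis" for \<phi> b
  proof -
    have "(\<integral>x. u x * partial b \<phi> x \<partial>lebesgue_on \<Omega>) = 0"
      by (rule integral_eq_zero_AE) (use u in eventually_elim, simp)
    then show ?thesis using W that by (simp add: weak_gradient_def)
  qed
  have orth: "L2_inner \<Omega> g (classical_grad \<phi>) = 0" if \<phi>: "\<phi> \<in> test_functions \<Omega>" for \<phi>
  proof -
    have "L2_inner \<Omega> g (classical_grad \<phi>) = (\<integral>x. (\<Sum>b\<in>Basis. (g x \<bullet> b) * partial b \<phi> x) \<partial>lebesgue_on \<Omega>)"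
      unfolding L2_inner_def by (simp add: classical_grad_def inner_sum_right mult.commute)
    also have "\<dots> = (\<Sum>b\<in>Basis. \<integral>x. (g x \<bullet> b) * partial b \<phi> x \<partial>lebesgue_on \<Omega>)"
      by (intro Bochner_Integration.integral_sum L2_times_integrable L2_component[OF g]
          test_function_L2[OF \<Omega>] partial_test_function \<phi>)
    also have "\<dots> = 0" by (intro sum.neutral ballI z partial_test_function \<phi>)
    finally show ?thesis .
  qed
  have "L2_inner \<Omega> g g \<le> 0"
  proof (rule field_le_epsilon)
    fix \<epsilon> :: real assume e: "\<epsilon> > 0"
    \<comment> \<open>The summand 1 only keeps the denominator positive.\<close>
    define K where "K = L2_norm \<Omega> g + 1"
    have K: "K > 0" using nonneg[OF g] by (simp add: K_def L2_norm_def add_nonneg_pos)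
    obtain \<phi> where \<phi>: "\<phi> \<in> test_functions \<Omega>" "L2_norm \<Omega> (g - classical_grad \<phi>) < \<epsilon> / K"
      using H e K unfolding H10_gradient_alt by (meson divide_pos_pos)
    have G: "classical_grad \<phi> \<in> L2 \<Omega>" by (rule classical_grad_L2[OF \<Omega> \<phi>(1)])
    have "L2_inner \<Omega> g g = L2_inner \<Omega> g (g - classical_grad \<phi>)"
      using diff_right[OF g G g] orth[OF \<phi>(1)] by simp
    also have "\<dots> \<le> L2_norm \<Omega> g * L2_norm \<Omega> (g - classical_grad \<phi>)"
      using Cauchy_Schwarz[OF g diff_mem[OF g G]] by (simp add: L2_norm_def)
    also have "\<dots> \<le> K * (\<epsilon> / K)"
      by (rule mult_mono) (use \<phi> K nonneg[OF diff_mem[OF g G]] in \<open>auto simp: K_def L2_norm_def\<close>)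
    finally show "L2_inner \<Omega> g g \<le> 0 + \<epsilon>" using K by simp
  qed
  then show ?thesis using nonneg[OF g] L2_inner_self_eq_0_iff[OF g] by simp
qed

lemma H10_gradient_unique:
  assumes \<Omega>: "open \<Omega>" "bounded \<Omega>" and "H10_gradient \<Omega> u g" "H10_gradient \<Omega> v h"
    and "AE x in lebesgue_on \<Omega>. u x = v x"
  shows "AE x in lebesgue_on \<Omega>. g x = h x"
proof -
  have "AE x in lebesgue_on \<Omega>. 1 *\<^sub>R g x + (-1) *\<^sub>R h x = 0"
    by (rule H10_gradient_of_null[OF \<Omega> H10_gradient_lin[OF \<Omega> assms(3,4), of 1 "-1"]])
      (use assms(5) in eventually_elim, simp)
  then show ?thesis by eventually_elim simp
qed

lemma grad: "u \<in> H10 \<Omega> \<Longrightarrow> H10_gradient \<Omega> u (grad \<Omega> u)"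
  using someI_ex[of "H10_gradient \<Omega> u"] by (simp add: H10_def grad_def)

lemma H10_L2: "u \<in> H10 \<Omega> \<Longrightarrow> u \<in> L2 \<Omega>"
  by (auto simp: H10_def H10_gradient_def)

lemma grad_L2: "u \<in> H10 \<Omega> \<Longrightarrow> grad \<Omega> u \<in> L2 \<Omega>"
  using grad by (auto simp: H10_gradient_def)

lemma H10_subspace:
  assumes \<Omega>: "open \<Omega>" "bounded \<Omega>"
  shows "linear_subspace (H10 \<Omega>)"
proof -
  have "(\<lambda>x. 0) \<in> test_functions \<Omega>"
  proof -
    have "C_k k (\<lambda>x::'a. 0)" for k
      by (induction k) (auto simp: partial_def[abs_def] frechet_derivative_const)
    then show ?thesis by (simp add: test_functions_def)
  qed
  then have "H10_gradient \<Omega> (\<lambda>x. 0) (\<lambda>x. 0)"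
    unfolding H10_gradient_def
    apply (intro conjI)
       apply (simp_all add: L2_def weak_gradient_def)
    apply (intro allI impI bexI[of _ "\<lambda>x. 0"])
    by (auto simp: L2_norm_def L2_inner_def classical_grad_def partial_def frechet_derivative_const)
  then show ?thesis
    unfolding linear_subspace_def H10_def
    using H10_gradient_lin[OF \<Omega>] by (auto; blast)
qed

lemma energy_cong:
  assumes \<Omega>: "open \<Omega>" "bounded \<Omega>" and H: "u \<in> H10 \<Omega>" "u' \<in> H10 \<Omega>" "v \<in> H10 \<Omega>"
    and ae: "AE x in lebesgue_on \<Omega>. u x = u' x"
  shows "energy \<Omega> u v = energy \<Omega> u' v"
  unfolding energy_def
  by (intro L2_inner_cong grad_L2 H H10_gradient_unique[OF \<Omega> grad grad] ae) simp

text \<open>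
  Linearity in the first argument is uniqueness of the gradient: the chosen gradient of a linear
  combination agrees almost everywhere with the combination of the chosen gradients.
\<close>

lemma energy_semi_inner_space:
  assumes \<Omega>: "open \<Omega>" "bounded \<Omega>"
  shows "semi_inner_space (H10 \<Omega>) (energy \<Omega>)"
proof
  show "linear_subspace (H10 \<Omega>)" by (rule H10_subspace[OF \<Omega>])
  interpret G: semi_inner_space "L2 \<Omega> :: ('a \<Rightarrow> 'a) set" "L2_inner \<Omega>" by (rule L2_semi_inner_space)
  fix u v w and a b :: real
  assume u: "u \<in> H10 \<Omega>"
  show "0 \<le> energy \<Omega> u u" unfolding energy_def by (intro G.nonneg grad_L2 u)
  assume v: "v \<in> H10 \<Omega>"
  show "energy \<Omega> u v = energy \<Omega> v u" unfolding energy_def by (intro G.sym grad_L2 u v)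
  assume w: "w \<in> H10 \<Omega>"
  let ?l = "\<lambda>x. a *\<^sub>R u x + b *\<^sub>R v x"
  have l: "H10_gradient \<Omega> ?l (\<lambda>x. a *\<^sub>R grad \<Omega> u x + b *\<^sub>R grad \<Omega> v x)"
    using H10_gradient_lin[OF \<Omega> grad[OF u] grad[OF v], of a b] by simp
  then have lH: "?l \<in> H10 \<Omega>" by (auto simp: H10_def)
  have "energy \<Omega> ?l w = L2_inner \<Omega> (\<lambda>x. a *\<^sub>R grad \<Omega> u x + b *\<^sub>R grad \<Omega> v x) (grad \<Omega> w)"
    unfolding energy_def
    by (intro L2_inner_cong grad_L2 lH w G.lin_mem u v H10_gradient_unique[OF \<Omega> grad[OF lH] l]) simp_all
  also have "\<dots> = a * energy \<Omega> u w + b * energy \<Omega> v w"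
    unfolding energy_def by (intro G.lin grad_L2 u v w)
  finally show "energy \<Omega> ?l w = a * energy \<Omega> u w + b * energy \<Omega> v w" .
qed

section \<open>Dimension modulo null sets\<close>

text \<open>
  Gaussian elimination: an equation with a nonzero coefficient at \<open>j0\<close> removes the unknown \<open>j0\<close>
  together with that equation.
\<close>

lemma homogeneous_system_nontrivial_solution:
  fixes A :: "'i \<Rightarrow> 'j \<Rightarrow> real"
  assumes "finite I" "finite J" "card I < card J"
  shows "\<exists>c. (\<exists>j\<in>J. c j \<noteq> 0) \<and> (\<forall>i\<in>I. (\<Sum>j\<in>J. A i j * c j) = 0)"
  using assms
proof (induction I arbitrary: J A)
  case empty
  then have "J \<noteq> {}" by auto
  then show ?case by (intro exI[of _ "\<lambda>_. 1"]) auto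
next
  case (insert i I)
  show ?case
  proof (cases "\<forall>j\<in>J. A i j = 0")
    case True
    have "card I < card J" using insert by simp
    from insert.IH[OF insert.prems(1) this, of A] True show ?thesis by auto
  next
    case False
    then obtain j0 where j0: "j0 \<in> J" "A i j0 \<noteq> 0" by blast
    let ?J = "J - {j0}"
    have "card I < card ?J" using insert j0 by simp
    from insert.IH[OF _ this, of "\<lambda>k j. A k j - A k j0 / A i j0 * A i j"] insert.prems(1)
    obtain c where c: "\<exists>j\<in>?J. c j \<noteq> 0"
      and c0: "\<And>k. k \<in> I \<Longrightarrow> (\<Sum>j\<in>?J. (A k j - A k j0 / A i j0 * A i j) * c j) = 0"
      by auto
    define s where "s = (\<Sum>j\<in>?J. A i j * c j)"
    define c' where "c' = c(j0 := - s / A i j0)"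
    have split: "(\<Sum>j\<in>J. A k j * c' j) = (\<Sum>j\<in>?J. A k j * c j) - A k j0 / A i j0 * s" for k
    proof -
      have "(\<Sum>j\<in>J. A k j * c' j) = A k j0 * c' j0 + (\<Sum>j\<in>?J. A k j * c' j)"
        by (rule sum.remove) (use insert j0 in auto)
      also have "(\<Sum>j\<in>?J. A k j * c' j) = (\<Sum>j\<in>?J. A k j * c j)"
        by (rule sum.cong) (auto simp: c'_def)
      finally show ?thesis by (simp add: c'_def)
    qed
    have "(\<Sum>j\<in>J. A k j * c' j) = 0" if "k \<in> I" for k
      using c0[OF that] unfolding split s_def
      by (simp add: left_diff_distrib sum_subtractf sum_distrib_left mult.assoc)
    moreover have "(\<Sum>j\<in>J. A i j * c' j) = 0" unfolding split using j0 by (simp add: s_def)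
    moreover have "\<exists>j\<in>J. c' j \<noteq> 0" using c by (auto simp: c'_def)
    ultimately show ?thesis by auto
  qed
qed

definition AE_independent :: "'a::euclidean_space set \<Rightarrow> ('i \<Rightarrow> 'a \<Rightarrow> real) \<Rightarrow> 'i set \<Rightarrow> bool" where
  "AE_independent \<Omega> w J \<longleftrightarrow>
     (\<forall>c. (AE x in lebesgue_on \<Omega>. (\<Sum>j\<in>J. c j * w j x) = 0) \<longrightarrow> (\<forall>j\<in>J. c j = 0))"

definition AE_span :: "'a::euclidean_space set \<Rightarrow> ('i \<Rightarrow> 'a \<Rightarrow> real) \<Rightarrow> 'i set \<Rightarrow> ('a \<Rightarrow> real) set" where
  "AE_span \<Omega> w J = {v. \<exists>c. AE x in lebesgue_on \<Omega>. v x = (\<Sum>j\<in>J. c j * w j x)}"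

lemma has_L2_dim_alt:
  "has_L2_dim \<Omega> W m \<longleftrightarrow>
     (\<exists>w. (\<forall>i<m. w i \<in> W) \<and> AE_independent \<Omega> w {..<m} \<and> W \<subseteq> AE_span \<Omega> w {..<m})"
  unfolding has_L2_dim_def AE_independent_def AE_span_def by (simp add: subset_iff Ball_def)

text \<open>
  If there were more functions than generators, a nontrivial solution of the homogeneous system
  given by their coefficients would be a linear relation between them.
\<close>

lemma AE_independent_card_le:
  assumes fin: "finite I" "finite J" and ind: "AE_independent \<Omega> w J"
    and span: "\<And>j. j \<in> J \<Longrightarrow> w j \<in> AE_span \<Omega> g I"
  shows "card J \<le> card I"
proof (rule ccontr)
  assume "\<not> card J \<le> card I"
  then have less: "card I < card J" by simp
  have "\<forall>j\<in>J. \<exists>c. AE x in lebesgue_on \<Omega>. w j x = (\<Sum>i\<in>I. c i * g i x)"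
    using span by (simp add: AE_span_def)
  then obtain A where A: "\<forall>j\<in>J. AE x in lebesgue_on \<Omega>. w j x = (\<Sum>i\<in>I. A j i * g i x)"
    by (rule bchoice[THEN exE])
  obtain c where c: "\<exists>j\<in>J. c j \<noteq> 0" "\<forall>i\<in>I. (\<Sum>j\<in>J. A j i * c j) = 0"
    using homogeneous_system_nontrivial_solution[OF fin less, of "\<lambda>i j. A j i"] by blast
  have "AE x in lebesgue_on \<Omega>. \<forall>j\<in>J. w j x = (\<Sum>i\<in>I. A j i * g i x)"
    using A by (intro AE_finite_allI fin) auto
  then have "AE x in lebesgue_on \<Omega>. (\<Sum>j\<in>J. c j * w j x) = 0"
  proof eventually_elim
    case (elim x)
    have "(\<Sum>j\<in>J. c j * w j x) = (\<Sum>j\<in>J. \<Sum>i\<in>I. A j i * c j * g i x)"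
      using elim by (intro sum.cong refl) (simp add: sum_distrib_left mult_ac)
    also have "\<dots> = (\<Sum>i\<in>I. (\<Sum>j\<in>J. A j i * c j) * g i x)"
      by (subst sum.swap) (simp add: sum_distrib_right)
    also have "\<dots> = 0" using c(2) by simp
    finally show ?case .
  qed
  then show False using ind c(1) unfolding AE_independent_def by blast
qed

text \<open>
  In a relation that involves the added function, its coefficient cannot vanish, so the relation
  can be solved for it.
\<close>

lemma AE_span_if_not_independent:
  assumes "finite J" "k \<notin> J" and ind: "AE_independent \<Omega> w J"
    and dep: "\<not> AE_independent \<Omega> (w(k := v)) (insert k J)"
  shows "v \<in> AE_span \<Omega> w J"
proof -
  obtain c where c: "AE x in lebesgue_on \<Omega>. (\<Sum>j\<in>insert k J. c j * (w(k := v)) j x) = 0"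
    and nz: "\<exists>j\<in>insert k J. c j \<noteq> 0"
    using dep unfolding AE_independent_def by blast
  have "(\<Sum>j\<in>J. c j * (w(k := v)) j x) = (\<Sum>j\<in>J. c j * w j x)" for x
    by (rule sum.cong) (use assms in auto)
  then have c: "AE x in lebesgue_on \<Omega>. c k * v x + (\<Sum>j\<in>J. c j * w j x) = 0"
    using c assms(1,2) by simp
  have ck: "c k \<noteq> 0"
  proof
    assume "c k = 0"
    then have "\<forall>j\<in>J. c j = 0" using c ind unfolding AE_independent_def by simp
    then show False using nz \<open>c k = 0\<close> by auto
  qed
  have "AE x in lebesgue_on \<Omega>. v x = (\<Sum>j\<in>J. (- c j / c k) * w j x)"
    using c
  proof eventually_elim
    case (elim x)
    then have "v x = - (\<Sum>j\<in>J. c j * w j x) / c k" using ck by (simp add: field_simps)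
    also have "\<dots> = (\<Sum>j\<in>J. (- c j / c k) * w j x)"
      by (simp add: sum_negf sum_divide_distrib)
    finally show ?case .
  qed
  then show ?thesis unfolding AE_span_def by (intro CollectI exI)
qed

lemma has_L2_dim_unique:
  assumes "has_L2_dim \<Omega> W m" "has_L2_dim \<Omega> W m'"
  shows "m = m'"
proof -
  have "m \<le> m'" if d: "has_L2_dim \<Omega> W m" "has_L2_dim \<Omega> W m'" for m m'
  proof -
    obtain w where "\<forall>i<m. w i \<in> W" "AE_independent \<Omega> w {..<m}"
      using d(1) unfolding has_L2_dim_alt by blast
    moreover obtain g where "W \<subseteq> AE_span \<Omega> g {..<m'}"
      using d(2) unfolding has_L2_dim_alt by blast
    ultimately show ?thesis using AE_independent_card_le[of "{..<m'}" "{..<m}" \<Omega> w g] by auto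
  qed
  then show ?thesis using assms by (meson le_antisym)
qed

text \<open>
  Otherwise the family could be enlarged beyond the dimension.
\<close>

lemma independent_spans_if_card_eq_dim:
  fixes e :: "nat \<Rightarrow> 'a::euclidean_space \<Rightarrow> real"
  assumes dim: "has_L2_dim \<Omega> W (card J)" and J: "finite J" "\<And>j. j \<in> J \<Longrightarrow> e j \<in> W"
    and ind: "AE_independent \<Omega> e J"
  shows "W \<subseteq> AE_span \<Omega> e J"
proof
  fix v assume v: "v \<in> W"
  obtain k where k: "k \<notin> J" using ex_new_if_finite[OF infinite_UNIV_nat J(1)] by blast
  obtain g where g: "W \<subseteq> AE_span \<Omega> g {..<card J}"
    using dim unfolding has_L2_dim_alt by blast
  show "v \<in> AE_span \<Omega> e J"
  proof (rule AE_span_if_not_independent[OF J(1) k ind], rule notI)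
    assume "AE_independent \<Omega> (e(k := v)) (insert k J)"
    then have "card (insert k J) \<le> card {..<card J}"
      by (rule AE_independent_card_le[rotated 2]) (use J v g in \<open>auto simp: subset_iff\<close>)
    then show False using J k by simp
  qed
qed

text \<open>
  An independent family in \<open>W\<close> of maximal length is a basis, and lengths are bounded by the number
  of generators.
\<close>

lemma has_L2_dim_exists:
  assumes "finite I" and span: "W \<subseteq> AE_span \<Omega> g I"
  shows "\<exists>m. has_L2_dim \<Omega> W m"
proof -
  define P where "P m \<longleftrightarrow> (\<exists>w. (\<forall>i<m. w i \<in> W) \<and> AE_independent \<Omega> w {..<m})" for m :: nat
  have "P 0" by (simp add: P_def AE_independent_def)
  moreover have bound: "k \<le> card I" if "P k" for k
  proof -
    obtain w where "\<forall>i<k. w i \<in> W" "AE_independent \<Omega> w {..<k}"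
      using \<open>P k\<close> unfolding P_def by blast
    then show ?thesis using AE_independent_card_le[of I "{..<k}" \<Omega> w g] assms by auto
  qed
  ultimately obtain m where m: "P m" "\<And>k. P k \<Longrightarrow> k \<le> m"
    using GreatestI_nat[of P 0 "card I"] Greatest_le_nat[of P _ "card I"] by blast
  obtain w where w: "\<forall>i<m. w i \<in> W" "AE_independent \<Omega> w {..<m}" using m(1) unfolding P_def by blast
  have "v \<in> AE_span \<Omega> w {..<m}" if v: "v \<in> W" for v
  proof (rule AE_span_if_not_independent[OF finite_lessThan _ w(2)])
    show "\<not> AE_independent \<Omega> (w(m := v)) (insert m {..<m})"
    proof
      assume "AE_independent \<Omega> (w(m := v)) (insert m {..<m})"
      moreover have "\<forall>i<Suc m. (w(m := v)) i \<in> W" using w(1) v by auto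
      ultimately have "P (Suc m)" unfolding P_def lessThan_Suc by blast
      then show False using m(2) by fastforce
    qed
  qed simp
  then show ?thesis using w unfolding has_L2_dim_alt by blast
qed

lemma L2_dim_eq: "has_L2_dim \<Omega> W m \<Longrightarrow> L2_dim \<Omega> W = m"
  unfolding L2_dim_def using has_L2_dim_unique by blast

lemma orthonormal_AE_independent:
  assumes J: "finite J" "\<And>j. j \<in> J \<Longrightarrow> e j \<in> L2 \<Omega>"
    and on: "\<And>i j. i \<in> J \<Longrightarrow> j \<in> J \<Longrightarrow> L2_inner \<Omega> (e i) (e j) = (if i = j then 1 else 0)"
  shows "AE_independent \<Omega> e J"
  unfolding AE_independent_def
proof (intro allI impI ballI)
  interpret semi_inner_space "L2 \<Omega>" "L2_inner \<Omega>" by (rule L2_semi_inner_space)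
  fix c j assume ae: "AE x in lebesgue_on \<Omega>. (\<Sum>j\<in>J. c j * e j x) = 0" and j: "j \<in> J"
  have "L2_inner \<Omega> (\<lambda>x. \<Sum>j\<in>J. c j *\<^sub>R e j x) (e j) = (\<Sum>i\<in>J. c i * L2_inner \<Omega> (e i) (e j))"
    by (intro sum_left J j)
  also have "\<dots> = (\<Sum>i\<in>J. if i = j then c j else 0)"
    by (rule sum.cong) (use on j in auto)
  also have "\<dots> = c j" using J j by simp
  finally show "c j = 0"
    using integral_eq_zero_AE[of "\<lambda>x. (\<Sum>j\<in>J. c j * e j x) \<bullet> e j x" "lebesgue_on \<Omega>"] ae
    unfolding L2_inner_def by (simp add: eventually_mono)
qed

section \<open>The finite element space\<close>

lemma polys_lin:
  assumes "f \<in> polys p" "g \<in> polys p"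
  shows "(\<lambda>x. a * f x + b * g x) \<in> polys p"
proof -
  obtain c d where
    f: "f = (\<lambda>x. \<Sum>\<alpha> | \<alpha> \<in> Basis \<rightarrow>\<^sub>E {..p} \<and> sum \<alpha> Basis \<le> p. c \<alpha> * (\<Prod>b\<in>Basis. (x \<bullet> b) ^ \<alpha> b))" and
    g: "g = (\<lambda>x. \<Sum>\<alpha> | \<alpha> \<in> Basis \<rightarrow>\<^sub>E {..p} \<and> sum \<alpha> Basis \<le> p. d \<alpha> * (\<Prod>b\<in>Basis. (x \<bullet> b) ^ \<alpha> b))"
    using assms unfolding polys_def by blast
  show ?thesis unfolding polys_def
    by (intro CollectI exI[of _ "\<lambda>\<alpha>. a * c \<alpha> + b * d \<alpha>"])
      (simp add: f g sum_distrib_left distrib_right sum.distrib mult.assoc)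
qed

lemma FE_space_subspace:
  assumes "open \<Omega>" "bounded \<Omega>"
  shows "linear_subspace (FE_space \<Omega> \<T> p)"
proof -
  note H = H10_subspace[OF assms]
  have 0: "(\<lambda>x. 0) \<in> FE_space \<Omega> \<T> p"
  proof -
    have "(\<lambda>x::'a. 0) \<in> polys p" unfolding polys_def by (intro CollectI exI[of _ "\<lambda>_. 0"]) simp
    then show ?thesis using H by (auto simp: FE_space_def linear_subspace_def intro!: bexI)
  qed
  have "(\<lambda>x. a *\<^sub>R f x + b *\<^sub>R g x) \<in> FE_space \<Omega> \<T> p"
    if f: "f \<in> FE_space \<Omega> \<T> p" and g: "g \<in> FE_space \<Omega> \<T> p" for f g a b
    unfolding FE_space_def
  proof (intro CollectI conjI ballI)
    show "(\<lambda>x. a *\<^sub>R f x + b *\<^sub>R g x) \<in> H10 \<Omega>"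
      by (rule linear_subspaceD[OF H]) (use f g in \<open>auto simp: FE_space_def\<close>)
    fix K assume "K \<in> \<T>"
    then obtain q r where q: "q \<in> polys p" "AE x in lebesgue_on (K \<inter> \<Omega>). f x = q x"
      and r: "r \<in> polys p" "AE x in lebesgue_on (K \<inter> \<Omega>). g x = r x"
      using f g unfolding FE_space_def by blast
    have "AE x in lebesgue_on (K \<inter> \<Omega>). a *\<^sub>R f x + b *\<^sub>R g x = a * q x + b * r x"
      using q(2) r(2) by eventually_elim simp
    then show "\<exists>q\<in>polys p. AE x in lebesgue_on (K \<inter> \<Omega>). a *\<^sub>R f x + b *\<^sub>R g x = q x"
      using polys_lin[OF q(1) r(1)] by (intro bexI)
  qed
  with 0 show ?thesis by (auto simp: linear_subspace_def)
qed

text \<open>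
  The generators are the monomials cut off to single simplices. Neighbours share faces, so the
  function \<open>\<kappa>\<close> assigns each point to one simplex containing it, and points of a common face
  contribute only once.
\<close>

lemma FE_space_finitely_spanned:
  fixes \<Omega> :: "'a::euclidean_space set"
  assumes mesh: "simplicial_mesh \<Omega> \<T>" and \<Omega>: "open \<Omega>"
  shows "\<exists>(I :: ('a set \<times> ('a \<Rightarrow> nat)) set) g. finite I \<and> FE_space \<Omega> \<T> p \<subseteq> AE_span \<Omega> g I"
proof -
  define A where "A = {\<alpha> \<in> Basis \<rightarrow>\<^sub>E {..p}. sum \<alpha> (Basis::'a set) \<le> p}"
  have finA: "finite A" unfolding A_def by (rule finite_subset[of _ "Basis \<rightarrow>\<^sub>E {..p}"]) (auto intro: finite_PiE)
  have finT: "finite \<T>" and K: "\<And>K. K \<in> \<T> \<Longrightarrow> int DIM('a) simplex K" and U: "\<Union>\<T> = closure \<Omega>"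
    using mesh by (auto simp: simplicial_mesh_def triangulation_def)
  define \<kappa> where "\<kappa> x = (SOME K. K \<in> \<T> \<and> x \<in> K)" for x
  have \<kappa>: "\<kappa> x \<in> \<T> \<and> x \<in> \<kappa> x" if "x \<in> \<Omega>" for x
  proof -
    have "\<exists>K. K \<in> \<T> \<and> x \<in> K" using that U closure_subset by blast
    then show ?thesis unfolding \<kappa>_def by (rule someI_ex)
  qed
  define g where "g = (\<lambda>(K, \<alpha>) x. if \<kappa> x = K then \<Prod>b\<in>Basis. (x \<bullet> b) ^ \<alpha> b else 0)"
  have "v \<in> AE_span \<Omega> g (\<T> \<times> A)" if v: "v \<in> FE_space \<Omega> \<T> p" for v
  proof -
    have "\<forall>K\<in>\<T>. \<exists>c. AE x in lebesgue_on (K \<inter> \<Omega>). v x = (\<Sum>\<alpha>\<in>A. c \<alpha> * (\<Prod>b\<in>Basis. (x \<bullet> b) ^ \<alpha> b))"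
      using v unfolding FE_space_def polys_def A_def by blast
    then obtain c where c: "\<forall>K\<in>\<T>. AE x in lebesgue_on (K \<inter> \<Omega>).
        v x = (\<Sum>\<alpha>\<in>A. c K \<alpha> * (\<Prod>b\<in>Basis. (x \<bullet> b) ^ \<alpha> b))"
      by (rule bchoice[THEN exE])
    have "AE x in lebesgue_on \<Omega>. x \<in> K \<longrightarrow> v x = (\<Sum>\<alpha>\<in>A. c K \<alpha> * (\<Prod>b\<in>Basis. (x \<bullet> b) ^ \<alpha> b))"
      if "K \<in> \<T>" for K
    proof -
      have "K \<in> sets lebesgue" "\<Omega> \<in> sets lebesgue"
        using K[OF that] \<Omega> by (auto intro!: borel_closed borel_open simp: compact_imp_closed compact_simplex)
      then show ?thesis using bspec[OF c that]
        by (auto simp: AE_restrict_space_iff elim!: eventually_mono)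
    qed
    then have "AE x in lebesgue_on \<Omega>. \<forall>K\<in>\<T>. x \<in> K \<longrightarrow>
        v x = (\<Sum>\<alpha>\<in>A. c K \<alpha> * (\<Prod>b\<in>Basis. (x \<bullet> b) ^ \<alpha> b))"
      using finT by (intro AE_finite_allI)
    moreover have "AE x in lebesgue_on \<Omega>. x \<in> \<Omega>"
      by (rule AE_I2) simp
    ultimately have "AE x in lebesgue_on \<Omega>. v x = (\<Sum>i\<in>\<T> \<times> A. c (fst i) (snd i) * g i x)"
    proof eventually_elim
      case (elim x)
      have "(\<Sum>i\<in>\<T> \<times> A. c (fst i) (snd i) * g i x)
          = (\<Sum>K\<in>\<T>. if K = \<kappa> x then \<Sum>\<alpha>\<in>A. c K \<alpha> * (\<Prod>b\<in>Basis. (x \<bullet> b) ^ \<alpha> b) else 0)"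
        unfolding sum.cartesian_product'
        by (intro sum.cong refl) (auto simp: g_def)
      also have "\<dots> = (\<Sum>\<alpha>\<in>A. c (\<kappa> x) \<alpha> * (\<Prod>b\<in>Basis. (x \<bullet> b) ^ \<alpha> b))"
        using \<kappa>[OF elim(2)] finT by simp
      also have "\<dots> = v x" using elim(1) \<kappa>[OF elim(2)] by metis
      finally show ?case by simp
    qed
    then show ?thesis unfolding AE_span_def by (intro CollectI exI)
  qed
  then show ?thesis using finT finA by (intro exI[of _ "\<T> \<times> A"] exI[of _ g]) auto
qed

lemma FE_space_has_L2_dim:
  assumes "simplicial_mesh \<Omega> \<T>" "open \<Omega>"
  shows "has_L2_dim \<Omega> (FE_space \<Omega> \<T> p) (L2_dim \<Omega> (FE_space \<Omega> \<T> p))"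
proof -
  obtain m where "has_L2_dim \<Omega> (FE_space \<Omega> \<T> p) m"
    using FE_space_finitely_spanned[OF assms] has_L2_dim_exists by blast
  then show ?thesis by (simp add: L2_dim_eq)
qed

section \<open>Projections and the maximal projection error\<close>

text \<open>
  The difference \<open>z\<close> between the projection of a sum and the sum of the projections lies in \<open>W\<close> and
  is orthogonal to \<open>W\<close>, hence to itself. For a definite form this is linearity of the projection.
\<close>

lemma (in semi_inner_space) projection_of_sum:
  assumes W: "linear_subspace W" "W \<subseteq> X"
    and Q: "\<And>f. f \<in> X \<Longrightarrow> Q f \<in> W \<and> (\<forall>v\<in>W. B (f - Q f) v = 0)"
    and I: "finite I" "\<And>i. i \<in> I \<Longrightarrow> u i \<in> X"
    and f: "f = (\<lambda>x. \<Sum>i\<in>I. c i *\<^sub>R u i x)"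
  defines "z \<equiv> Q f - (\<lambda>x. \<Sum>i\<in>I. c i *\<^sub>R Q (u i) x)"
  shows "z \<in> W" "B z z = 0"
proof -
  have fX: "f \<in> X" unfolding f by (rule sum_mem[OF I])
  have QW: "Q f \<in> W" "\<And>i. i \<in> I \<Longrightarrow> Q (u i) \<in> W" using Q fX I by auto
  have sW: "(\<lambda>x. \<Sum>i\<in>I. c i *\<^sub>R Q (u i) x) \<in> W"
    by (intro linear_subspace_sum W I QW)
  show zW: "z \<in> W" unfolding z_def by (intro linear_subspace_diff[OF W(1)] QW sW)
  have zX: "z \<in> X" using zW W by auto
  have dX: "f - Q f \<in> X" "\<And>i. i \<in> I \<Longrightarrow> u i - Q (u i) \<in> X"
    using diff_mem fX I QW W by blast+
  have eX: "(\<lambda>x. \<Sum>i\<in>I. c i *\<^sub>R (u i - Q (u i)) x) \<in> X" by (intro sum_mem I dX)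
  have z: "z = (\<lambda>x. \<Sum>i\<in>I. c i *\<^sub>R (u i - Q (u i)) x) - (f - Q f)"
    unfolding z_def f by (auto simp: scaleR_diff_right sum_subtractf)
  have "B z z = B (\<lambda>x. \<Sum>i\<in>I. c i *\<^sub>R (u i - Q (u i)) x) z - B (f - Q f) z"
    by (subst (1) z, rule diff_left[OF eX dX(1) zX])
  also have "B (\<lambda>x. \<Sum>i\<in>I. c i *\<^sub>R (u i - Q (u i)) x) z = (\<Sum>i\<in>I. c i * B (u i - Q (u i)) z)"
    by (intro sum_left I dX zX)
  also have "\<dots> = 0" using Q I zW by (intro sum.neutral) auto
  also have "B (f - Q f) z = 0" using Q[OF fX] zW by blast
  finally show "B z z = 0" by simp
qed

lemma L2_norm_sq_orthonormal:
  assumes I: "finite I" "\<And>i. i \<in> I \<Longrightarrow> u i \<in> L2 \<Omega>"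
    and on: "\<And>i j. i \<in> I \<Longrightarrow> j \<in> I \<Longrightarrow> L2_inner \<Omega> (u i) (u j) = (if i = j then 1 else 0)"
  shows "L2_norm \<Omega> (\<lambda>x. \<Sum>i\<in>I. c i * u i x) = sqrt (\<Sum>i\<in>I. (c i)\<^sup>2)"
proof -
  interpret semi_inner_space "L2 \<Omega>" "L2_inner \<Omega>" by (rule L2_semi_inner_space)
  let ?f = "\<lambda>x. \<Sum>i\<in>I. c i *\<^sub>R u i x"
  have "L2_inner \<Omega> ?f ?f = (\<Sum>i\<in>I. c i * L2_inner \<Omega> (u i) ?f)"
    by (intro sum_left sum_mem I)
  also have "\<dots> = (\<Sum>i\<in>I. (c i)\<^sup>2)"
  proof (rule sum.cong[OF refl])
    fix i assume i: "i \<in> I"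
    have "L2_inner \<Omega> (u i) ?f = (\<Sum>j\<in>I. c j * L2_inner \<Omega> (u i) (u j))" by (intro sum_right I i)
    also have "\<dots> = (\<Sum>j\<in>I. if j = i then c i else 0)" by (rule sum.cong) (use on i in auto)
    finally show "c i * L2_inner \<Omega> (u i) ?f = (c i)\<^sup>2" using I i by (simp add: power2_eq_square)
  qed
  finally show ?thesis by (simp add: L2_norm_def)
qed

text \<open>
  The projection may be taken for any form \<open>B\<close> that is definite on \<open>W\<close>, but the error is measured in
  \<open>L\<^sup>2\<close>. By linearity of \<open>Q\<close> the error of \<open>\<Sum>i. c i u i\<close> is the \<open>L\<^sup>2\<close> norm of \<open>\<Sum>i. c i (u i - Q (u i))\<close>,
  and orthonormality turns the unit sphere into the unit sphere of coefficients, where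
  \<open>max_on_unit_coefficients\<close> applies.
\<close>

lemma max_proj_err_attained:
  assumes S: "semi_inner_space X B" and X: "X \<subseteq> L2 \<Omega>"
    and W: "linear_subspace W" "W \<subseteq> X"
    and definite: "\<And>z. z \<in> W \<Longrightarrow> B z z = 0 \<Longrightarrow> AE x in lebesgue_on \<Omega>. z x = 0"
    and Q: "\<And>f. f \<in> X \<Longrightarrow> Q f \<in> W \<and> (\<forall>v\<in>W. B (f - Q f) v = 0)"
    and I: "finite I" "I \<noteq> {}" "\<And>i. i \<in> I \<Longrightarrow> u i \<in> X"
    and on: "\<And>i j. i \<in> I \<Longrightarrow> j \<in> I \<Longrightarrow> L2_inner \<Omega> (u i) (u j) = (if i = j then 1 else 0)"
  obtains v where "v \<in> unit_sphere \<Omega> (lin_span u I)"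
    "max_proj_err \<Omega> (lin_span u I) Q = L2_norm \<Omega> (v - Q v)"
    "\<And>w. w \<in> unit_sphere \<Omega> (lin_span u I) \<Longrightarrow>
       L2_norm \<Omega> (w - Q w) \<le> max_proj_err \<Omega> (lin_span u I) Q"
proof -
  interpret B: semi_inner_space X B by (rule S)
  interpret L: semi_inner_space "L2 \<Omega>" "L2_inner \<Omega>" by (rule L2_semi_inner_space)
  define F where "F c = (\<lambda>x. \<Sum>i\<in>I. c i * u i x)" for c
  define e where "e i = u i - Q (u i)" for i
  have eX: "e i \<in> L2 \<Omega>" if "i \<in> I" for i
    unfolding e_def using B.diff_mem I(3)[OF that] Q W X by blast
  have err: "L2_norm \<Omega> (F c - Q (F c)) = L2_norm \<Omega> (\<lambda>x. \<Sum>i\<in>I. c i *\<^sub>R e i x)" for c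
  proof -
    have Fs: "F c = (\<lambda>x. \<Sum>i\<in>I. c i *\<^sub>R u i x)" by (simp add: F_def)
    have FX: "F c \<in> X" unfolding Fs by (intro B.sum_mem I)
    note z = B.projection_of_sum[OF W Q I(1,3) Fs]
    have "AE x in lebesgue_on \<Omega>. (Q (F c) - (\<lambda>x. \<Sum>i\<in>I. c i *\<^sub>R Q (u i) x)) x = 0"
      by (rule definite[OF z])
    then have "AE x in lebesgue_on \<Omega>. (F c - Q (F c)) x = (\<Sum>i\<in>I. c i *\<^sub>R e i x)"
      by eventually_elim (simp add: Fs e_def algebra_simps sum_subtractf)
    moreover have "F c - Q (F c) \<in> L2 \<Omega>" using B.diff_mem FX Q W X by blast
    ultimately show ?thesis by (intro L2_norm_cong L.sum_mem I eX)
  qed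
  have sphere: "unit_sphere \<Omega> (lin_span u I) = F ` {c. (\<Sum>i\<in>I. (c i)\<^sup>2) = 1}"
  proof -
    have uL: "u i \<in> L2 \<Omega>" if "i \<in> I" for i using I(3)[OF that] X by blast
    have "L2_norm \<Omega> (F c) = sqrt (\<Sum>i\<in>I. (c i)\<^sup>2)" for c
      unfolding F_def by (rule L2_norm_sq_orthonormal[OF I(1) uL on])
    then show ?thesis unfolding unit_sphere_def lin_span_def by (auto simp: F_def[symmetric])
  qed
  let ?e = "\<lambda>c x. \<Sum>i\<in>I. c i *\<^sub>R e i x"
  obtain c where c: "(\<Sum>i\<in>I. (c i)\<^sup>2) = 1"
    and max: "\<forall>d. (\<Sum>i\<in>I. (d i)\<^sup>2) = 1 \<longrightarrow>
      L2_inner \<Omega> (?e d) (?e d) \<le> L2_inner \<Omega> (?e c) (?e c)"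
    using L.max_on_unit_coefficients[where e = e, OF I(1,2) eX] by blast
  have v: "F c \<in> unit_sphere \<Omega> (lin_span u I)" unfolding sphere using c by blast
  have le: "L2_norm \<Omega> (w - Q w) \<le> L2_norm \<Omega> (F c - Q (F c))"
    if w: "w \<in> unit_sphere \<Omega> (lin_span u I)" for w
  proof -
    obtain d where d: "w = F d" "(\<Sum>i\<in>I. (d i)\<^sup>2) = 1" using w unfolding sphere by blast
    have "L2_norm \<Omega> (?e d) \<le> L2_norm \<Omega> (?e c)"
      unfolding L2_norm_def by (rule real_sqrt_le_mono[OF max[rule_format, OF d(2)]])
    then show ?thesis unfolding d(1) err .
  qed
  have "max_proj_err \<Omega> (lin_span u I) Q = L2_norm \<Omega> (F c - Q (F c))"
    unfolding max_proj_err_def by (rule Greatest_equality) (use v le in auto)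
  then show thesis using that[OF v] le by simp
qed

lemma lin_span_subspace: "linear_subspace (lin_span u I)"
  unfolding linear_subspace_def
proof (intro conjI ballI allI)
  show "(\<lambda>x. 0) \<in> lin_span u I" unfolding lin_span_def by (intro CollectI exI[of _ "\<lambda>_. 0"]) simp
  fix f g a b assume "f \<in> lin_span u I" "g \<in> lin_span u I"
  then obtain c d where "f = (\<lambda>x. \<Sum>i\<in>I. c i * u i x)" "g = (\<lambda>x. \<Sum>i\<in>I. d i * u i x)"
    unfolding lin_span_def by blast
  then show "(\<lambda>x. a *\<^sub>R f x + b *\<^sub>R g x) \<in> lin_span u I"
    unfolding lin_span_def
    by (intro CollectI exI[of _ "\<lambda>i. a * c i + b * d i"])
      (simp add: sum_distrib_left distrib_right sum.distrib mult.assoc)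
qed

lemma lin_span_base:
  assumes "finite I" "i \<in> I"
  shows "u i \<in> lin_span u I"
proof -
  have "u i x = (\<Sum>j\<in>I. (if j = i then 1 else 0) * u j x)" for x
    using assms by (simp add: if_distrib[where f = "\<lambda>t. t * _"] cong: if_cong)
  then show ?thesis
    unfolding lin_span_def by (intro CollectI exI[of _ "\<lambda>j. if j = i then 1 else 0"]) auto
qed

lemma lin_span_subset:
  assumes "linear_subspace W" "finite I" "\<And>i. i \<in> I \<Longrightarrow> u i \<in> W"
  shows "lin_span u I \<subseteq> W"
  using linear_subspace_sum[OF assms] by (auto simp: lin_span_def)

text \<open>
  The least factor is \<open>(SUP s\<in>S. a s) / M\<close>. Finiteness of this supremum is why the defining
  condition of \<open>\<beta>\<close> can be met at all.
\<close>

lemma least_factor_attained: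
  fixes a :: "'s \<Rightarrow> real"
  assumes "S \<noteq> {}" and nn: "\<And>s. s \<in> S \<Longrightarrow> 0 \<le> a s" and bd: "\<And>s. s \<in> S \<Longrightarrow> a s \<le> C" and M: "0 < M"
  defines "\<beta> \<equiv> LEAST \<beta>. 0 \<le> \<beta> \<and> (\<forall>s\<in>S. a s \<le> \<beta> * M)"
  shows "0 \<le> \<beta> \<and> (\<forall>s\<in>S. a s \<le> \<beta> * M)"
proof -
  define b where "b = (SUP s\<in>S. a s) / M"
  have bdd: "bdd_above (a ` S)" using bd by (auto simp: bdd_above_def)
  have up: "a s \<le> b * M" if "s \<in> S" for s
    using cSUP_upper[OF that bdd] M by (simp add: b_def)
  obtain s where s: "s \<in> S" using assms(1) by blast
  have b0: "0 \<le> b" using up[OF s] nn[OF s] M by (metis order_trans zero_le_mult_iff not_less order_less_imp_le)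
  have "\<beta> = b" unfolding \<beta>_def
  proof (rule Least_equality)
    show "0 \<le> b \<and> (\<forall>s\<in>S. a s \<le> b * M)" using b0 up by blast
    fix y assume "0 \<le> y \<and> (\<forall>s\<in>S. a s \<le> y * M)"
    then have "(SUP s\<in>S. a s) \<le> y * M" using assms(1) by (intro cSUP_least) auto
    then show "b \<le> y" using M by (simp add: b_def pos_divide_le_eq)
  qed
  then show ?thesis using b0 up by blast
qed

lemma L2_proj_props:
  assumes uh: "\<And>j. j \<in> J \<Longrightarrow> uh j \<in> L2 \<Omega>" and J: "finite J"
    and on: "\<And>i j. i \<in> J \<Longrightarrow> j \<in> J \<Longrightarrow> L2_inner \<Omega> (uh i) (uh j) = (if i = j then 1 else 0)"
    and f: "f \<in> L2 \<Omega>"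
  shows "L2_proj \<Omega> (lin_span uh J) f \<in> lin_span uh J \<and>
    (\<forall>v\<in>lin_span uh J. L2_inner \<Omega> (f - L2_proj \<Omega> (lin_span uh J) f) v = 0)"
proof -
  interpret semi_inner_space "L2 \<Omega>" "L2_inner \<Omega>" by (rule L2_semi_inner_space)
  have "\<exists>w. w \<in> lin_span uh J \<and> (\<forall>v\<in>lin_span uh J. L2_inner \<Omega> (f - w) v = 0)"
  proof (rule orthogonal_projection_exists[where e = uh and J = J and d = "\<lambda>_. 1"])
    show "lin_span uh J \<subseteq> L2 \<Omega>" by (rule lin_span_subset[OF subspace J uh])
    show "\<exists>c. \<forall>g\<in>L2 \<Omega>. L2_inner \<Omega> g v = L2_inner \<Omega> g (\<lambda>x. \<Sum>j\<in>J. c j *\<^sub>R uh j x)"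
      if "v \<in> lin_span uh J" for v
      using that by (auto simp: lin_span_def)
  qed (use lin_span_subspace lin_span_base J on f in auto)
  then show ?thesis unfolding L2_proj_def by (rule someI_ex)
qed

text \<open>
  The family \<open>uh\<close> spans \<open>V\<close> only up to null sets, which the energy does not see.
\<close>

lemma energy_proj_props:
  assumes \<Omega>: "open \<Omega>" "bounded \<Omega>" and V: "linear_subspace V" "V \<subseteq> H10 \<Omega>"
    and J: "finite J" "\<And>j. j \<in> J \<Longrightarrow> uh j \<in> V" and span: "V \<subseteq> AE_span \<Omega> uh J"
    and orth: "\<And>i j. i \<in> J \<Longrightarrow> j \<in> J \<Longrightarrow> energy \<Omega> (uh i) (uh j) = (if i = j then lamh i else 0)"
    and pos: "\<And>j. j \<in> J \<Longrightarrow> lamh j \<noteq> 0"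
    and f: "f \<in> H10 \<Omega>"
  shows "energy_proj \<Omega> V f \<in> V \<and> (\<forall>v\<in>V. energy \<Omega> (f - energy_proj \<Omega> V f) v = 0)"
proof -
  interpret semi_inner_space "H10 \<Omega>" "energy \<Omega>" by (rule energy_semi_inner_space[OF \<Omega>])
  have "\<exists>w. w \<in> V \<and> (\<forall>v\<in>V. energy \<Omega> (f - w) v = 0)"
  proof (rule orthogonal_projection_exists[where e = uh and J = J and d = lamh])
    fix v assume v: "v \<in> V"
    obtain c where c: "AE x in lebesgue_on \<Omega>. v x = (\<Sum>j\<in>J. c j * uh j x)"
      using v span unfolding AE_span_def by blast
    have s: "(\<lambda>x. \<Sum>j\<in>J. c j *\<^sub>R uh j x) \<in> H10 \<Omega>" using linear_subspace_sum[where u = uh, OF V(1) J] V by blast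
    have vH: "v \<in> H10 \<Omega>" using v V by blast
    have "energy \<Omega> g v = energy \<Omega> g (\<lambda>x. \<Sum>j\<in>J. c j *\<^sub>R uh j x)" if g: "g \<in> H10 \<Omega>" for g
      using energy_cong[OF \<Omega> vH s g] c sym[OF g vH] sym[OF g s] by simp
    then show "\<exists>c. \<forall>g\<in>H10 \<Omega>. energy \<Omega> g v = energy \<Omega> g (\<lambda>x. \<Sum>j\<in>J. c j *\<^sub>R uh j x)" by blast
  qed (use assms in auto)
  then show ?thesis unfolding energy_proj_def by (rule someI_ex)
qed

section \<open>Eigenfunctions\<close>

text \<open>
  A function of energy 0 is energy-orthogonal to everything, so it is an eigenfunction for the
  eigenvalue 0. As all listed eigenvalues are positive, that eigenspace has dimension 0.
\<close>

lemma energy_definite: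
  assumes \<Omega>: "open \<Omega>" "bounded \<Omega>" and eig: "eigensystem \<Omega> (H10 \<Omega>) {1..} lam u" and pos: "0 < lam 1"
    and w: "w \<in> H10 \<Omega>" "energy \<Omega> w w = 0"
  shows "AE x in lebesgue_on \<Omega>. w x = 0"
proof -
  interpret semi_inner_space "H10 \<Omega>" "energy \<Omega>" by (rule energy_semi_inner_space[OF \<Omega>])
  have "lam i > 0" if "i \<ge> 1" for i
    using eig that pos monotone_onD[of "{1..}" "(\<le>)" "(\<le>)" lam 1 i] by (force simp: eigensystem_def)
  then have empty: "{i \<in> {1..}. lam i = 0} = {}" by force
  have "has_L2_dim \<Omega> (eigenspace \<Omega> (H10 \<Omega>) 0) (card {i \<in> {1..}. lam i = 0})"
    using eig unfolding eigensystem_def by blast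
  then have "has_L2_dim \<Omega> (eigenspace \<Omega> (H10 \<Omega>) 0) 0" unfolding empty by simp
  moreover have "w \<in> eigenspace \<Omega> (H10 \<Omega>) 0"
    using w null_orthogonal by (auto simp: eigenspace_def)
  ultimately show ?thesis by (simp add: has_L2_dim_def)
qed

lemma discrete_eigenfunctions_span:
  assumes \<Omega>: "open \<Omega>" and mesh: "simplicial_mesh \<Omega> \<T>" and V: "V = FE_space \<Omega> \<T> p"
    and eig: "eigensystem \<Omega> V {1..L2_dim \<Omega> V} lamh uh"
  shows "V \<subseteq> AE_span \<Omega> uh {1..L2_dim \<Omega> V}"
proof (rule independent_spans_if_card_eq_dim)
  show "has_L2_dim \<Omega> V (card {1..L2_dim \<Omega> V})"
    using FE_space_has_L2_dim[OF mesh \<Omega>] by (simp add: V)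
  show mem: "uh j \<in> V" if "j \<in> {1..L2_dim \<Omega> V}" for j
    using eig that unfolding eigensystem_def eigenspace_def by blast
  show "AE_independent \<Omega> uh {1..L2_dim \<Omega> V}"
  proof (rule orthonormal_AE_independent)
    show "uh j \<in> L2 \<Omega>" if "j \<in> {1..L2_dim \<Omega> V}" for j
      using mem[OF that] by (auto simp: V FE_space_def intro: H10_L2)
  qed (use eig in \<open>auto simp: eigensystem_def\<close>)
qed simp

text \<open>
  The multiplicity clause of \<open>eigensystem\<close> says that the orthonormal eigenfunctions listed for \<open>\<mu>\<close>
  are as many as the dimension of the eigenspace.
\<close>

lemma eigenspace_spanned_by_eigenfunctions:
  assumes eig: "eigensystem \<Omega> V J lamh uh" and V: "V \<subseteq> L2 \<Omega>"
  shows "eigenspace \<Omega> V \<mu> \<subseteq> AE_span \<Omega> uh {j \<in> J. lamh j = \<mu>}"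
proof (rule independent_spans_if_card_eq_dim)
  show "has_L2_dim \<Omega> (eigenspace \<Omega> V \<mu>) (card {j \<in> J. lamh j = \<mu>})" and fin: "finite {j \<in> J. lamh j = \<mu>}"
    using eig unfolding eigensystem_def by blast+
  show mem: "uh j \<in> eigenspace \<Omega> V \<mu>" if "j \<in> {j \<in> J. lamh j = \<mu>}" for j
    using eig that unfolding eigensystem_def by blast
  show "AE_independent \<Omega> uh {j \<in> J. lamh j = \<mu>}"
    by (rule orthonormal_AE_independent[OF fin])
      (use mem V eig in \<open>auto simp: eigensystem_def eigenspace_def\<close>)
qed


section \<open>The cluster estimate\<close>

theorem lemma2:
  fixes \<Omega> :: "'a::euclidean_space set"
    and \<T> :: "'a set set"
    and p n N :: nat
    and lam lamh :: "nat \<Rightarrow> real"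
    and u uh :: "nat \<Rightarrow> 'a \<Rightarrow> real"
    and V E Eh :: "('a \<Rightarrow> real) set"
  assumes "lipschitz_polytope \<Omega>"
    and "simplicial_mesh \<Omega> \<T>"
    and "V = FE_space \<Omega> \<T> p"
    and "eigensystem \<Omega> (H10 \<Omega>) {1..} lam u"
    and "0 < lam 1"
    and "eigensystem \<Omega> V {1..L2_dim \<Omega> V} lamh uh"
    and "\<And>i j. i \<in> {1..L2_dim \<Omega> V} \<Longrightarrow> j \<in> {1..L2_dim \<Omega> V} \<Longrightarrow>
           energy \<Omega> (uh i) (uh j) = (if i = j then lamh i else 0)"
    and "1 \<le> n" and "n \<le> N" and "N \<le> L2_dim \<Omega> V"
    and "E = lin_span u {n..N}"
    and "Eh = lin_span uh {n..N}"
    and "1 \<le> n - 1 \<Longrightarrow> lamh (n - 1) < lam n"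
    and "N + 1 \<le> L2_dim \<Omega> V \<Longrightarrow> lam N < lamh (N + 1)"
  shows "directed_dist \<Omega> E Eh = max_proj_err \<Omega> E (L2_proj \<Omega> Eh) \<and>
         max_proj_err \<Omega> E (L2_proj \<Omega> Eh)
           \<le> (1 + cluster_beta \<Omega> V E Eh) * max_proj_err \<Omega> E (energy_proj \<Omega> V)"
proof -
  have \<Omega>: "open \<Omega>" "bounded \<Omega>" using assms(1) by (auto simp: lipschitz_polytope_def)
  interpret L: semi_inner_space "L2 \<Omega>" "L2_inner \<Omega>" by (rule L2_semi_inner_space)
  interpret H: semi_inner_space "H10 \<Omega>" "energy \<Omega>" by (rule energy_semi_inner_space[OF \<Omega>])
  let ?D = "{1..L2_dim \<Omega> V}" and ?C = "{n..N}"
  let ?P = "energy_proj \<Omega> V" and ?Q = "L2_proj \<Omega> Eh"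
  let ?S = "unit_sphere \<Omega> E" and ?M = "max_proj_err \<Omega> E (energy_proj \<Omega> V)"
  have CD: "?C \<subseteq> ?D" using assms(8,10) by auto
  have C: "finite ?C" "?C \<noteq> {}" using assms(9) by auto
  have HL: "H10 \<Omega> \<subseteq> L2 \<Omega>" using H10_L2 by blast
  have VH: "V \<subseteq> H10 \<Omega>" by (auto simp: assms(3) FE_space_def)
  have Vsub: "linear_subspace V" unfolding assms(3) by (rule FE_space_subspace[OF \<Omega>])
  have uH: "u i \<in> H10 \<Omega>" if "i \<ge> 1" for i
    using assms(4) that by (auto simp: eigensystem_def eigenspace_def)
  have u_on: "L2_inner \<Omega> (u i) (u j) = (if i = j then 1 else 0)" if "i \<in> ?C" "j \<in> ?C" for i j
    using assms(4,8) that by (auto simp: eigensystem_def)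
  have uhV: "uh j \<in> V" if "j \<in> ?D" for j
    using assms(6) that by (auto simp: eigensystem_def eigenspace_def)
  have uh_on: "L2_inner \<Omega> (uh i) (uh j) = (if i = j then 1 else 0)" if "i \<in> ?D" "j \<in> ?D" for i j
    using assms(6) that by (auto simp: eigensystem_def)
  have EH: "E \<subseteq> H10 \<Omega>" unfolding assms(11)
    by (rule lin_span_subset[OF H.subspace]) (use uH assms(8) in auto)
  have EhV: "Eh \<subseteq> V" unfolding assms(12)
    by (rule lin_span_subset[OF Vsub]) (use uhV CD in auto)
  have EhL: "Eh \<subseteq> L2 \<Omega>" using EhV VH HL by blast
  have Ehsub: "linear_subspace Eh" unfolding assms(12) by (rule lin_span_subspace)

  have definite: "AE x in lebesgue_on \<Omega>. w x = 0" if "w \<in> H10 \<Omega>" "energy \<Omega> w w = 0" for w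
    by (rule energy_definite[OF \<Omega> assms(4,5) that])
  have lamh_nz: "lamh j \<noteq> 0" if j: "j \<in> ?D" for j
  proof
    assume "lamh j = 0"
    then have "energy \<Omega> (uh j) (uh j) = 0" using assms(7)[OF j j] by simp
    then have "AE x in lebesgue_on \<Omega>. uh j x = 0" using definite uhV[OF j] VH by blast
    then have "L2_inner \<Omega> (uh j) (uh j) = 0" using L2_inner_self_eq_0_iff uhV[OF j] VH HL by blast
    then show False using uh_on j by simp
  qed
  have P: "?P f \<in> V \<and> (\<forall>v\<in>V. energy \<Omega> (f - ?P f) v = 0)" if "f \<in> H10 \<Omega>" for f
    by (rule energy_proj_props[OF \<Omega> Vsub VH _ uhV
          discrete_eigenfunctions_span[OF \<Omega>(1) assms(2,3,6)] assms(7) lamh_nz that]) auto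
  have Q: "?Q f \<in> Eh \<and> (\<forall>v\<in>Eh. L2_inner \<Omega> (f - ?Q f) v = 0)" if "f \<in> L2 \<Omega>" for f
    unfolding assms(12)
  proof (rule L2_proj_props[OF _ C(1) uh_on that])
    show "uh j \<in> L2 \<Omega>" if "j \<in> ?C" for j using uhV CD VH HL that by blast
  qed (use CD in auto)
  have best: "L2_norm \<Omega> (f - ?Q f) \<le> L2_norm \<Omega> (f - w)" if "f \<in> L2 \<Omega>" "w \<in> Eh" for f w
    unfolding L2_norm_def
    using L.best_approximation[OF Ehsub EhL that(1) _ that(2)] Q[OF that(1)] by simp

  have uC: "u i \<in> H10 \<Omega>" if "i \<in> ?C" for i using uH that assms(8) by auto
  obtain vP where vP: "vP \<in> ?S" "?M = L2_norm \<Omega> (vP - ?P vP)"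
    and maxP: "\<And>w. w \<in> ?S \<Longrightarrow> L2_norm \<Omega> (w - ?P w) \<le> ?M"
    unfolding assms(11)
    by (rule max_proj_err_attained[OF H.semi_inner_space_axioms HL Vsub VH _ P C uC u_on])
      (use definite VH in blast)+
  obtain vQ where vQ: "vQ \<in> ?S" "max_proj_err \<Omega> E ?Q = L2_norm \<Omega> (vQ - ?Q vQ)"
    unfolding assms(11)
    by (rule max_proj_err_attained[OF L.semi_inner_space_axioms subset_refl Ehsub EhL _ Q C _ u_on])
      (use L2_inner_self_eq_0_iff EhL uC HL in blast)+

  have SL: "v \<in> L2 \<Omega>" "v \<in> H10 \<Omega>" "L2_norm \<Omega> v = 1" if "v \<in> ?S" for v
    using that EH HL by (auto simp: unit_sphere_def)
  have "(LEAST s. \<exists>w\<in>Eh. s = L2_norm \<Omega> (v - w)) = L2_norm \<Omega> (v - ?Q v)" if "v \<in> ?S" for v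
    by (rule Least_equality) (use best Q SL[OF that] in auto)
  then have eq: "directed_dist \<Omega> E Eh = max_proj_err \<Omega> E ?Q"
    unfolding directed_dist_def max_proj_err_def by (intro arg_cong[where f = Greatest]) auto

  have triv: "0 \<le> L2_norm \<Omega> f" for f :: "'a \<Rightarrow> real" by (simp add: L2_norm_def L2_inner_def)
  have "L2_norm \<Omega> (v - ?Q v) \<le> (1 + cluster_beta \<Omega> V E Eh) * ?M" if v: "v \<in> ?S" for v
  proof (cases "\<forall>u\<in>?S. L2_norm \<Omega> (u - ?P u) = 0")
    case False
    then obtain v0 where "v0 \<in> ?S" "L2_norm \<Omega> (v0 - ?P v0) \<noteq> 0" by blast
    then have M: "0 < ?M" using maxP[of v0] triv[of "v0 - ?P v0"] by linarith
    let ?a = "\<lambda>w. L2_norm \<Omega> (?P w - ?Q (?P w))"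
    have PL: "?P w \<in> L2 \<Omega>" if "w \<in> ?S" for w using P SL[OF that] VH HL by blast
    \<comment> \<open>Any uniform bound will do; it makes the set of admissible \<open>\<beta>\<close> nonempty.\<close>
    have bound: "?a w \<le> 1 + ?M" if w: "w \<in> ?S" for w
    proof -
      have z: "(\<lambda>x. 0) \<in> Eh" "(\<lambda>x. 0 :: real) \<in> L2 \<Omega>"
        using Ehsub EhL by (auto simp: linear_subspace_def)
      have "?a w \<le> L2_norm \<Omega> (?P w - (\<lambda>x. 0))" by (rule best[OF PL[OF w] z(1)])
      also have "\<dots> \<le> L2_norm \<Omega> (?P w - w) + L2_norm \<Omega> (w - (\<lambda>x. 0))"
        unfolding L2_norm_def by (rule L.triangle[OF PL[OF w] SL(1)[OF w] z(2)])
      also have "L2_norm \<Omega> (?P w - w) = L2_norm \<Omega> (w - ?P w)"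
        by (simp add: L2_norm_def L2_inner_def algebra_simps)
      finally have "?a w \<le> L2_norm \<Omega> (w - ?P w) + L2_norm \<Omega> (w - (\<lambda>x. 0))" .
      moreover have "w - (\<lambda>x. 0) = w" by auto
      ultimately have "?a w \<le> L2_norm \<Omega> (w - ?P w) + 1" using SL(3)[OF w] by (simp only:)
      then show ?thesis using maxP[OF w] by linarith
    qed
    have "0 \<le> cluster_beta \<Omega> V E Eh \<and> (\<forall>w\<in>?S. ?a w \<le> cluster_beta \<Omega> V E Eh * ?M)"
      unfolding cluster_beta_def if_not_P[OF False]
      by (rule least_factor_attained[OF _ triv bound M]) (use v in auto)
    then have \<beta>: "?a v \<le> cluster_beta \<Omega> V E Eh * ?M" using v by blast
    have QP: "?Q (?P v) \<in> Eh" using Q[OF PL[OF v]] by blast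
    have "L2_norm \<Omega> (v - ?Q v) \<le> L2_norm \<Omega> (v - ?Q (?P v))" by (rule best[OF SL(1)[OF v] QP])
    also have "\<dots> \<le> L2_norm \<Omega> (v - ?P v) + ?a v"
      unfolding L2_norm_def by (rule L.triangle[OF SL(1)[OF v] PL[OF v]]) (use QP EhL in blast)
    also have "\<dots> \<le> ?M + cluster_beta \<Omega> V E Eh * ?M" by (intro add_mono maxP v \<beta>)
    finally show ?thesis by (simp add: distrib_right)
  next
    case True
    \<comment> \<open>The bound is now 0, so \<open>E\<close> must lie in \<open>Eh\<close> up to null sets.\<close>
    have "?M = 0" using True vP by simp
    have "\<exists>w\<in>Eh. AE x in lebesgue_on \<Omega>. u i x = w x" if i: "i \<in> ?C" for i
    proof -
      have "L2_norm \<Omega> (u i) = 1" using u_on[OF i i] by (simp add: L2_norm_def)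
      then have "u i \<in> ?S" using lin_span_base[OF C(1) i, of u] by (simp add: unit_sphere_def assms(11))
      then have z: "L2_norm \<Omega> (u i - ?P (u i)) = 0" using True by blast
      define w where "w = ?P (u i)"
      have w: "w \<in> V" "\<And>v. v \<in> V \<Longrightarrow> energy \<Omega> (u i - w) v = 0"
        using P[OF uC[OF i]] by (auto simp: w_def)
      have wH: "w \<in> H10 \<Omega>" using w VH by blast
      have "AE x in lebesgue_on \<Omega>. (u i - w) x = 0"
        using z L2_norm_eq_0_iff[OF L.diff_mem] uC[OF i] wH HL unfolding w_def by blast
      then have ae: "AE x in lebesgue_on \<Omega>. u i x = w x" by eventually_elim simp
      have "energy \<Omega> w v = lam i * L2_inner \<Omega> w v" if v: "v \<in> V" for v
      proof -
        have vH: "v \<in> H10 \<Omega>" using v VH by blast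
        have "energy \<Omega> w v = energy \<Omega> (u i) v"
          using w(2)[OF v] H.diff_left[OF uC[OF i] wH vH] by simp
        also have "\<dots> = lam i * L2_inner \<Omega> (u i) v"
          using assms(4,8) i vH by (auto simp: eigensystem_def eigenspace_def)
        also have "L2_inner \<Omega> (u i) v = L2_inner \<Omega> w v"
          by (rule L2_inner_cong) (use uC[OF i] wH vH HL ae in auto)
        finally show ?thesis .
      qed
      then have "w \<in> eigenspace \<Omega> V (lam i)" using w by (simp add: eigenspace_def)
      then obtain c where c: "AE x in lebesgue_on \<Omega>. w x = (\<Sum>j\<in>{j\<in>?D. lamh j = lam i}. c j * uh j x)"
        using eigenspace_spanned_by_eigenfunctions[OF assms(6)] VH HL unfolding AE_span_def by blast
      have monoh: "lamh j \<le> lamh k" if "j \<in> ?D" "k \<in> ?D" "j \<le> k" for j k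
        using assms(6) that by (auto simp: eigensystem_def monotone_on_def)
      have mono: "lam j \<le> lam k" if "1 \<le> j" "j \<le> k" for j k
        using assms(4) that by (auto simp: eigensystem_def monotone_on_def)
      have "{j\<in>?D. lamh j = lam i} \<subseteq> ?C"
      proof
        fix j assume j: "j \<in> {j\<in>?D. lamh j = lam i}"
        have "lam n \<le> lam i" "lam i \<le> lam N" using mono i assms(8) by auto
        moreover have "lamh j < lam n" if "j < n"
        proof -
          have "1 \<le> n - 1" "lamh j \<le> lamh (n - 1)"
            using monoh[of j "n - 1"] j that assms(9,10) by auto
          then show ?thesis using assms(13) by linarith
        qed
        moreover have "lam N < lamh j" if "N < j"
        proof -
          have "N + 1 \<le> L2_dim \<Omega> V" "lamh (N + 1) \<le> lamh j"
            using monoh[of "N + 1" j] j that by auto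
          then show ?thesis using assms(14) by linarith
        qed
        ultimately show "j \<in> ?C" using j by force
      qed
      then have "(\<lambda>x. \<Sum>j\<in>{j\<in>?D. lamh j = lam i}. c j *\<^sub>R uh j x) \<in> Eh"
        by (intro linear_subspace_sum[OF Ehsub]) (auto simp: assms(12) intro!: lin_span_base)
      moreover have "AE x in lebesgue_on \<Omega>. u i x = (\<Sum>j\<in>{j\<in>?D. lamh j = lam i}. c j *\<^sub>R uh j x)"
        using ae c by eventually_elim simp
      ultimately show ?thesis
        by (intro bexI[where x = "\<lambda>x. \<Sum>j\<in>{j\<in>?D. lamh j = lam i}. c j *\<^sub>R uh j x"])
    qed
    then have "\<forall>i\<in>?C. \<exists>w. w \<in> Eh \<and> (AE x in lebesgue_on \<Omega>. u i x = w x)" by blast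
    then obtain w where w: "\<forall>i\<in>?C. w i \<in> Eh \<and> (AE x in lebesgue_on \<Omega>. u i x = w i x)"
      by (rule bchoice[THEN exE])
    obtain c where c: "v = (\<lambda>x. \<Sum>i\<in>?C. c i * u i x)"
      using v by (auto simp: unit_sphere_def assms(11) lin_span_def)
    let ?w = "\<lambda>x. \<Sum>i\<in>?C. c i *\<^sub>R w i x"
    have wE: "?w \<in> Eh" by (rule linear_subspace_sum[OF Ehsub C(1)]) (use w in blast)
    have "AE x in lebesgue_on \<Omega>. \<forall>i\<in>?C. u i x = w i x" using w by (intro AE_finite_allI C) blast
    then have "AE x in lebesgue_on \<Omega>. (v - ?w) x = 0"
      by eventually_elim (simp add: c)
    then have "L2_norm \<Omega> (v - ?w) = 0"
      using L2_norm_eq_0_iff[OF L.diff_mem] SL[OF v] wE EhL by blast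
    then show ?thesis using best[OF SL(1)[OF v] wE] \<open>?M = 0\<close> by simp
  qed
  then show ?thesis using eq vQ by simp
qed

end
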